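(* Let $\omega=e^{2\pi i/3}$ and let $n\ge 3$ be an integer. Let $T$ be the directed graph consisting of the points of $\mathbb{Z}[\omega]$ in the interior of the equilateral triangle with vertices $0,\ n,\ -n\omega^{-1}$, together with one additional root vertex (the wired boundary), where each interior point $v$ has three outgoing edges of weight $1$, towards $v+1$, $v+\omega$ and $v+\omega^{-1}$, and any such edge whose endpoint lies on the boundary of the triangle is directed to the root vertex instead. Then the number of directed spanning trees of $T$ rooted at the wired boundary vertex is $$\prod_{\substack{\alpha,\beta,\gamma\\ \alpha\beta\gamma=1\\ \alpha^{3n}=1\\ (\alpha/\beta)^n=1\\ \alpha,\beta,\gamma\ \text{distinct}}}(3-\alpha-\beta-\gamma)^{1/6},$$ where the product is over ordered triples of complex numbers $(\alpha,\beta,\gamma)$ satisfying the listed conditions.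
   Context: A directed spanning tree rooted at a vertex $\rho$ is a connected acyclic set of directed edges in which every vertex other than $\rho$ has exactly one outgoing edge and $\rho$ has none. Parallel edges to the root are counted as different edges. The six permutations of an ordered triple $(\alpha,\beta,\gamma)$ all occur in the product and give the same value $3-\alpha-\beta-\gamma$; the exponent $1/6$ means that each unordered triple $\{\alpha,\beta,\gamma\}$ contributes the factor $3-\alpha-\beta-\gamma$ exactly once. *)

theory Defs
  imports "Graph_Theory.Digraph_Component" "HOL-Analysis.Analysis"
begin

definition omega :: complex where
  "omega = exp (2 * of_real pi * \<i> / 3)"

definition eisenstein_ints :: "complex set" where
  "eisenstein_ints = {of_int a + of_int b * omega | a b. True}"

definition triangle :: "nat \<Rightarrow> complex set" where
  "triangle n = convex hull {0, of_nat n, - of_nat n * inverse omega}"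

definition interior_points :: "nat \<Rightarrow> complex set" where
  "interior_points n = eisenstein_ints \<inter> interior (triangle n)"

text \<open>The wired boundary vertex is \<open>None\<close>. An arc is a pair of its tail and its direction
  (rather than its head), so that several arcs from one point to the root remain different.\<close>

definition triangle_digraph :: "nat \<Rightarrow> (complex option, complex \<times> complex) pre_digraph" where
  "triangle_digraph n =
    \<lparr> verts = insert None (Some ` interior_points n),
      arcs = interior_points n \<times> {1, omega, inverse omega},
      tail = (\<lambda>(v, d). Some v),
      head = (\<lambda>(v, d). if v + d \<in> frontier (triangle n) then None else Some (v + d)) \<rparr>"

text \<open>The library's constant \<open>spanning_tree\<close> asks for connectedness of the underlying undirected graph
  and excludes directed cycles only; together with the out-degree conditions this excludes
  undirected cycles as well.\<close>

definition directed_spanning_tree :: "('a, 'b) pre_digraph \<Rightarrow> 'a \<Rightarrow> 'b set \<Rightarrow> bool" where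
  "directed_spanning_tree G \<rho> F \<longleftrightarrow>
    (let H = G\<lparr>arcs := F\<rparr> in
      spanning_tree H G \<and> \<rho> \<in> verts G \<and> out_arcs H \<rho> = {} \<and>
      (\<forall>v \<in> verts G - {\<rho>}. out_degree H v = 1))"

definition eigen_triples :: "nat \<Rightarrow> (complex \<times> complex \<times> complex) set" where
  "eigen_triples n = {(\<alpha>, \<beta>, \<gamma>). \<alpha> * \<beta> * \<gamma> = 1 \<and> \<alpha> ^ (3 * n) = 1 \<and> (\<alpha> / \<beta>) ^ n = 1 \<and>
    \<alpha> \<noteq> \<beta> \<and> \<beta> \<noteq> \<gamma> \<and> \<alpha> \<noteq> \<gamma>}"

end

theory Submission
  imports Defs "Jordan_Normal_Form.Determinant"
begin

text \<open>By the matrix-tree theorem the number of trees is the determinant of the Laplacian \<open>\<Delta>\<close> of the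
  interior points, with zero boundary values. For \<open>(\<alpha>, \<beta>, \<gamma>)\<close> with \<open>\<alpha> \<beta> \<gamma> = 1\<close>, the function
  \<open>\<alpha>\<^sup>a \<beta>\<^sup>b\<close> of the point \<open>a + b \<omega>\<close> is multiplied by \<open>\<alpha>\<close>, \<open>\<beta>\<close>, \<open>\<gamma>\<close> under the three steps.
  Its antisymmetrization over the six permutations of \<open>(\<alpha>, \<beta>, \<gamma>)\<close> vanishes on two sides of the triangle,
  and on the third side if \<open>\<alpha>\<^sup>n = \<beta>\<^sup>n = \<gamma>\<^sup>n\<close>, so it is an eigenvector of \<open>\<Delta>\<close> with eigenvalue
  \<open>3 - \<alpha> - \<beta> - \<gamma>\<close>. The unordered triples of distinct numbers with these properties are
  in bijection with the interior points, and orthogonality of the characters of the finite group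
  of all such triples shows that the eigenvectors form a basis.\<close>

unbundle no vec_syntax

section \<open>The directed matrix-tree theorem\<close>

text \<open>A permutation with a nonzero term in the Leibniz expansion moves \<open>i\<close> only to its successor \<open>h i\<close>,
  so without cycles only the identity contributes. If there is a cycle, the indicator of the
  vertices leading to it lies in the kernel.\<close>

lemma det_id_minus_functional_graph:
  fixes h :: "nat \<Rightarrow> nat option" and m :: nat
  defines "R \<equiv> {(i, j). i < m \<and> j < m \<and> h i = Some j}"
  defines "A \<equiv> mat m m (\<lambda>(i, j). of_bool (i = j) - of_bool (h i = Some j)) :: 'a :: idom mat"
  shows "Determinant.det A = of_bool (acyclic R)"
proof (cases "acyclic R")
  case True
  have R_sub: "R \<subseteq> {..<m} \<times> {..<m}"
    by (auto simp: R_def)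
  have "finite R"
    using finite_subset[OF R_sub] by blast
  with True have wf: "wf (R\<inverse>)"
    by (simp add: finite_acyclic_wf_converse)
  have no_loop: "h i \<noteq> Some i" if "i < m" for i
    using True that by (auto simp: R_def acyclic_def)
  have zero: "(\<Prod>i = 0..<m. A $$ (i, p i)) = 0" if p: "p permutes {0..<m}" "p \<noteq> id" for p
  proof (rule ccontr)
    assume nz: "(\<Prod>i = 0..<m. A $$ (i, p i)) \<noteq> 0"
    have p_lt: "p i < m" if "i < m" for i
      using permutes_in_image[OF p(1), of i] that by auto
    have choice: "p i = i \<or> h i = Some (p i)" if "i < m" for i
    proof -
      have "A $$ (i, p i) \<noteq> 0" using nz that by (simp add: prod_zero_iff)
      thus ?thesis using that p_lt[OF that] by (auto simp: A_def split: if_splits)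
    qed
    \<comment> \<open>Induction along the arrows from \<open>i\<close> to its successor: a moved
      \<open>i\<close> has \<open>p i\<close> as successor, which \<open>p\<close> fixes by
      hypothesis, and injectivity of \<open>p\<close> then gives \<open>p i = i\<close>.\<close>
    have "i < m \<longrightarrow> p i = i" for i
      using wf
    proof (induction i rule: wf_induct_rule)
      case (less i)
      show ?case
      proof
        assume i: "i < m"
        show "p i = i"
        proof (rule ccontr)
          assume ne: "p i \<noteq> i"
          with choice[OF i] have "h i = Some (p i)" by simp
          hence "(p i, i) \<in> R\<inverse>" using i p_lt[OF i] by (auto simp: R_def)
          with less p_lt[OF i] have "p (p i) = p i" by blast
          thus False using ne permutes_inj[OF p(1)] by (auto dest: injD)
        qed
      qed
    qed
    moreover have "p i = i" if "\<not> i < m" for i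
      using permutes_not_in[OF p(1)] that by auto
    ultimately have "p = id" by (auto simp: fun_eq_iff)
    with p(2) show False by simp
  qed
  have "Determinant.det A = (\<Sum>p | p permutes {0..<m}. signof p * (\<Prod>i = 0..<m. A $$ (i, p i)))"
    by (rule det_def') (simp add: A_def)
  also have "\<dots> = (\<Sum>p \<in> {id}. signof p * (\<Prod>i = 0..<m. A $$ (i, p i)))"
    by (rule sum.mono_neutral_right) (auto simp: zero finite_permutations permutes_id)
  also have "\<dots> = 1"
    by (simp add: A_def no_loop)
  finally show ?thesis using True by simp
next
  case False
  then obtain c where c: "(c, c) \<in> R\<^sup>+" by (auto simp: acyclic_def)
  define x where "x = Matrix.vec m (\<lambda>i. of_bool ((i, c) \<in> R\<^sup>+) :: 'a)"
  have cm: "c < m" using c by (induction rule: converse_trancl_induct) (auto simp: R_def)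
  \<comment> \<open>As \<open>c\<close> lies on a cycle, \<open>(c, c)\<close> is in
    \<open>R\<^sup>+\<close>, so reaching \<open>c\<close> is equivalent for \<open>i\<close> and
    for its successor even if that successor is \<open>c\<close> itself. This makes \<open>x\<close>
    a kernel vector.\<close>
  have step: "(i, c) \<in> R\<^sup>+ \<longleftrightarrow> (\<exists>j. h i = Some j \<and> (j, c) \<in> R\<^sup>+)" if "i < m" for i
  proof
    assume "(i, c) \<in> R\<^sup>+"
    then obtain j where "(i, j) \<in> R" "(j, c) \<in> R\<^sup>*" by (meson tranclD)
    thus "\<exists>j. h i = Some j \<and> (j, c) \<in> R\<^sup>+"
      using c by (auto simp: R_def rtrancl_eq_or_trancl)
  next
    assume "\<exists>j. h i = Some j \<and> (j, c) \<in> R\<^sup>+"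
    then obtain j where j: "h i = Some j" "(j, c) \<in> R\<^sup>+" by blast
    hence "j < m" by (auto simp: R_def dest: tranclD)
    with j that show "(i, c) \<in> R\<^sup>+" by (auto simp: R_def intro: trancl_into_trancl2)
  qed
  have lt: "j < m" if "(j, c) \<in> R\<^sup>+" for j
    using that by (auto simp: R_def dest: tranclD)
  have row: "(\<Sum>j = 0..<m. A $$ (i, j) * x $ j) = 0" if i: "i < m" for i
  proof -
    have "(\<Sum>j = 0..<m. A $$ (i, j) * x $ j) =
        (\<Sum>j = 0..<m. (if i = j then of_bool ((j, c) \<in> R\<^sup>+) else 0)) -
        (\<Sum>j = 0..<m. of_bool (h i = Some j) * of_bool ((j, c) \<in> R\<^sup>+))"
      unfolding sum_subtractf[symmetric]
      by (intro sum.cong refl) (use i in \<open>auto simp: A_def x_def algebra_simps\<close>)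
    also have "(\<Sum>j = 0..<m. (if i = j then of_bool ((j, c) \<in> R\<^sup>+) else 0)) = (of_bool ((i, c) \<in> R\<^sup>+) :: 'a)"
      using i by simp
    also have "(\<Sum>j = 0..<m. of_bool (h i = Some j) * of_bool ((j, c) \<in> R\<^sup>+)) = (of_bool ((i, c) \<in> R\<^sup>+) :: 'a)"
    proof (cases "h i")
      case None
      thus ?thesis using step[OF i] by simp
    next
      case (Some k)
      have "(\<Sum>j = 0..<m. of_bool (h i = Some j) * of_bool ((j, c) \<in> R\<^sup>+)) =
          (\<Sum>j = 0..<m. (if k = j then of_bool ((j, c) \<in> R\<^sup>+) else 0) :: 'a)"
        by (intro sum.cong refl) (use Some in auto)
      also have "\<dots> = of_bool ((k, c) \<in> R\<^sup>+)"
        using lt by auto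
      finally show ?thesis using step[OF i] Some by simp
    qed
    finally show ?thesis by simp
  qed
  have "A *\<^sub>v x = 0\<^sub>v m"
    by (rule eq_vecI) (use row in \<open>auto simp: A_def x_def scalar_prod_def\<close>)
  moreover have "x \<noteq> 0\<^sub>v m"
  proof
    assume "x = 0\<^sub>v m"
    hence "x $ c = 0" using cm by simp
    thus False using c cm by (simp add: x_def)
  qed
  moreover have "x \<in> carrier_vec m" by (simp add: x_def)
  moreover have "A \<in> carrier_mat m m" by (simp add: A_def)
  ultimately have "Determinant.det A = 0"
    using det_0_iff_vec_prod_zero by blast
  with False show ?thesis by simp
qed

text \<open>The sink \<open>\<rho>\<close> starts no pair of \<open>R\<close>, so no cycle passes
  through it and every cycle lifts along the injective \<open>e\<close>. This transfers acyclicity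
  between the vertices of a graph and their indices in a matrix.\<close>

lemma acyclic_pullback_insert_sink:
  assumes inj: "inj_on e I" and R: "R \<subseteq> e ` I \<times> insert \<rho> (e ` I)" and \<rho>: "\<rho> \<notin> e ` I"
  shows "acyclic {(i, j). i \<in> I \<and> j \<in> I \<and> (e i, e j) \<in> R} \<longleftrightarrow> acyclic R" (is "acyclic ?S \<longleftrightarrow> _")
proof -
  have push: "(e i, e j) \<in> R\<^sup>+" if "(i, j) \<in> ?S\<^sup>+" for i j
    using that
  proof (induction rule: trancl_induct)
    case (step j k)
    hence "(e j, e k) \<in> R" by simp
    with step.IH show ?case by (rule trancl_into_trancl)
  qed auto
  have pull: "y \<in> e ` I \<longrightarrow> (\<exists>i\<in>I. \<exists>j\<in>I. e i = x \<and> e j = y \<and> (i, j) \<in> ?S\<^sup>+)" if "(x, y) \<in> R\<^sup>+" for x y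
    using that
  proof (induction rule: trancl_induct)
    case (base y)
    hence "x \<in> e ` I" using R by auto
    with base show ?case by (auto intro!: r_into_trancl)
  next
    case (step y z)
    show ?case
    proof
      assume "z \<in> e ` I"
      then obtain k where k: "k \<in> I" "e k = z" by blast
      from step R have "y \<in> e ` I" by auto
      with step obtain i j where ij: "i \<in> I" "j \<in> I" "e i = x" "e j = y" "(i, j) \<in> ?S\<^sup>+" by blast
      have jk: "(j, k) \<in> ?S" using k step ij by simp
      have "(i, k) \<in> ?S\<^sup>+" by (rule trancl_into_trancl) (fact ij jk)+
      with ij k show "\<exists>i\<in>I. \<exists>k\<in>I. e i = x \<and> e k = z \<and> (i, k) \<in> ?S\<^sup>+" by blast
    qed
  qed
  have dom: "x \<in> e ` I" if "(x, y) \<in> R\<^sup>+" for x y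
    using that R by (auto dest: tranclD)
  show ?thesis
    unfolding acyclic_def
  proof (intro iffI allI notI)
    fix x assume *: "\<forall>i. (i, i) \<notin> ?S\<^sup>+" and x: "(x, x) \<in> R\<^sup>+"
    obtain i j where ij: "i \<in> I" "j \<in> I" "e i = x" "e j = x" "(i, j) \<in> ?S\<^sup>+"
      using pull[OF x] dom[OF x] by blast
    hence "i = j" by (intro inj_onD[OF inj]) auto
    with * ij(5) show False by blast
  next
    fix i assume *: "\<forall>x. (x, x) \<notin> R\<^sup>+" and i: "(i, i) \<in> ?S\<^sup>+"
    thus False using push[OF i] by blast
  qed
qed

section \<open>Directed spanning trees as acyclic sets of outgoing arcs\<close>

lemma (in wf_digraph) forest_iff_acyclic: "forest G \<longleftrightarrow> acyclic (arcs_ends G)"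
proof -
  have "(\<exists>p. cycle p) \<longleftrightarrow> (\<exists>v. v \<rightarrow>\<^sup>+ v)"
  proof
    assume "\<exists>p. cycle p"
    then obtain p u where "awalk u p u" "p \<noteq> []" by (auto simp: cycle_def)
    hence "u \<rightarrow>\<^sup>+ u" by (rule reachable1_awalkI)
    thus "\<exists>v. v \<rightarrow>\<^sup>+ v" ..
  next
    assume "\<exists>v. v \<rightarrow>\<^sup>+ v"
    then obtain u where "u \<rightarrow>\<^sup>+ u" ..
    then obtain p where "awalk u p u" "p \<noteq> []" unfolding reachable1_awalk by blast
    hence "closed_w p" by (auto simp: closed_w_def)
    thus "\<exists>p. cycle p" by (rule closed_w_imp_cycle)
  qed
  thus ?thesis by (auto simp: forest_def acyclic_def)
qed

text \<open>Following the outgoing arcs in a finite acyclic arc set must stop, and it can stop only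
  at \<open>\<rho>\<close>; this gives connectedness. What remains is a choice of one arc per
  vertex, as the determinant expansion produces it.\<close>

lemma directed_spanning_tree_iff:
  assumes G: "fin_digraph G" and \<rho>: "\<rho> \<in> verts G"
  shows "directed_spanning_tree G \<rho> F \<longleftrightarrow>
    F \<subseteq> arcs G \<and> (\<forall>a\<in>F. tail G a \<noteq> \<rho>) \<and> (\<forall>v\<in>verts G - {\<rho>}. \<exists>!a. a \<in> F \<and> tail G a = v) \<and>
    acyclic ((\<lambda>a. (tail G a, head G a)) ` F)"
proof -
  interpret fin_digraph G by (fact G)
  define H where "H = G\<lparr>arcs := F\<rparr>"
  have [simp]: "verts H = verts G" "arcs H = F" "tail H = tail G" "head H = head G"
    by (simp_all add: H_def)
  have ends: "arcs_ends H = (\<lambda>a. (tail G a, head G a)) ` F"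
    by (simp add: arcs_ends_conv)
  have out: "out_arcs H v = {a \<in> F. tail G a = v}" for v
    by (auto simp: out_arcs_def)
  have deg: "out_degree H v = 1 \<longleftrightarrow> (\<exists>!a. a \<in> F \<and> tail G a = v)" for v
    unfolding out_degree_def out One_nat_def card_1_singleton_iff by (simp add: set_eq_iff Ex1_def) metis
  have wf_H: "wf_digraph H" if "F \<subseteq> arcs G"
    using that by unfold_locales auto
  have sub: "spanning H G \<longleftrightarrow> F \<subseteq> arcs G"
    using wf_H wf_digraph by (auto simp: spanning_def subgraph_def compatible_def)
  have conn: "connected H" if F: "F \<subseteq> arcs G" and ac: "acyclic (arcs_ends H)"
    and deg1: "\<forall>v\<in>verts G - {\<rho>}. \<exists>!a. a \<in> F \<and> tail G a = v"
  proof -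
    interpret H: wf_digraph H using wf_H[OF F] .
    \<comment> \<open>Connectedness means strong connectedness of the symmetrized digraph, where
      walks towards \<open>\<rho>\<close> can be reversed.\<close>
    let ?S = "with_proj (mk_symmetric H)"
    interpret S: wf_digraph ?S
      by (intro wf_digraph_wp_iff[THEN iffD2] H.wellformed_mk_symmetric)
    have sym: "symmetric ?S"
      by (simp add: symmetric_mk_symmetric)
    have "finite (arcs_ends H)"
      using finite_subset[OF F finite_arcs] by (simp add: ends)
    with ac have wf: "wf ((arcs_ends H)\<inverse>)" by (simp add: finite_acyclic_wf_converse)
    have "v \<in> verts G \<longrightarrow> v \<rightarrow>\<^sup>*\<^bsub>?S\<^esub> \<rho>" for v
      using wf
    proof (induction v rule: wf_induct_rule)
      case (less v)
      show ?case
      proof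
        assume v: "v \<in> verts G"
        show "v \<rightarrow>\<^sup>*\<^bsub>?S\<^esub> \<rho>"
        proof (cases "v = \<rho>")
          case True
          with v show ?thesis by simp
        next
          case False
          with v deg1 obtain a where a: "a \<in> F" "tail G a = v" by blast
          hence "(v, head G a) \<in> arcs_ends H" by (auto simp: ends)
          moreover have "head G a \<in> verts G" using a F by auto
          ultimately have "head G a \<rightarrow>\<^sup>*\<^bsub>?S\<^esub> \<rho>" using less by blast
          moreover have "v \<rightarrow>\<^bsub>?S\<^esub> head G a"
            using a by (auto simp: parcs_mk_symmetric arcs_ends_conv)
          ultimately show ?thesis by (metis S.adj_reachable_trans)
        qed
      qed
    qed
    hence reach: "v \<rightarrow>\<^sup>*\<^bsub>?S\<^esub> \<rho>" if "v \<in> verts G" for v using that by blast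
    show ?thesis
      unfolding connected_def
    proof (rule strongly_connectedI)
      show "verts ?S \<noteq> {}" using \<rho> by auto
      fix u v assume "u \<in> verts ?S" "v \<in> verts ?S"
      hence "u \<in> verts G" "v \<in> verts G" by simp_all
      from reach[OF this(1)] symmetric_reachable[OF sym reach[OF this(2)]]
      show "u \<rightarrow>\<^sup>*\<^bsub>?S\<^esub> v" by (rule S.reachable_trans)
    qed
  qed
  show ?thesis
    unfolding directed_spanning_tree_def Let_def H_def[symmetric] spanning_tree_def tree_def sub out deg
    using \<rho> conn wf_digraph.forest_iff_acyclic[OF wf_H] unfolding ends by auto
qed

text \<open>Row \<open>v\<close> of the Laplacian is the sum, over the arcs \<open>a\<close> leaving \<open>v\<close>, of the rows of
  single arcs. Expanding the determinant over these choices leaves one functional graph per choice.\<close>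

theorem matrix_tree_directed:
  fixes G :: "('a, 'b) pre_digraph" and e :: "nat \<Rightarrow> 'a"
  assumes G: "fin_digraph G" and \<rho>: "\<rho> \<in> verts G" and e: "bij_betw e {0..<m} (verts G - {\<rho>})"
  shows "Determinant.det (mat m m (\<lambda>(i, j). \<Sum>a\<in>out_arcs G (e i). of_bool (i = j) - of_bool (head G a = e j)))
    = (of_nat (card {F. directed_spanning_tree G \<rho> F}) :: 'c :: idom)"
proof -
  interpret fin_digraph G by (fact G)
  define P where "P = PiE {0..<m} (\<lambda>i. out_arcs G (e i))"
  define M where "M = (\<lambda>\<phi>. mat m m (\<lambda>(i, j). of_bool (i = j) - of_bool (head G (\<phi> i) = e j)) :: 'c mat)"
  define Q where "Q = {\<phi> \<in> P. acyclic ((\<lambda>i. (e i, head G (\<phi> i))) ` {0..<m})}"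
  have inj: "inj_on e {0..<m}" and img: "e ` {0..<m} = verts G - {\<rho>}"
    using e by (auto simp: bij_betw_def)
  have finP: "finite P" unfolding P_def by (intro finite_PiE) auto
  have out: "\<phi> i \<in> arcs G" "tail G (\<phi> i) = e i" if "\<phi> \<in> P" "i < m" for \<phi> i
    using that by (auto simp: P_def PiE_iff)
  have perm_lt: "p i < m" if "p permutes {0..<m}" "i < m" for p i
    using permutes_in_image[OF that(1), of i] that(2) by auto
  have "Determinant.det (mat m m (\<lambda>(i, j). \<Sum>a\<in>out_arcs G (e i). of_bool (i = j) - of_bool (head G a = e j)) :: 'c mat)
      = (\<Sum>p | p permutes {0..<m}. signof p *
          (\<Prod>i = 0..<m. \<Sum>a\<in>out_arcs G (e i). of_bool (i = p i) - of_bool (head G a = e (p i))))"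
    by (subst det_def') (auto intro!: sum.cong prod.cong simp: perm_lt)
  also have "\<dots> = (\<Sum>p | p permutes {0..<m}. signof p *
      (\<Sum>\<phi>\<in>P. \<Prod>i = 0..<m. of_bool (i = p i) - of_bool (head G (\<phi> i) = e (p i))))"
    unfolding P_def by (subst prod_sum_PiE) auto
  also have "\<dots> = (\<Sum>\<phi>\<in>P. \<Sum>p | p permutes {0..<m}. signof p *
      (\<Prod>i = 0..<m. of_bool (i = p i) - of_bool (head G (\<phi> i) = e (p i))))"
    unfolding sum_distrib_left by (rule sum.swap)
  also have "\<dots> = (\<Sum>\<phi>\<in>P. Determinant.det (M \<phi>))"
    by (intro sum.cong refl, subst det_def') (auto intro!: sum.cong prod.cong simp: perm_lt M_def)
  also have "\<dots> = (\<Sum>\<phi>\<in>P. of_bool (\<phi> \<in> Q))"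
  proof (intro sum.cong refl)
    fix \<phi> assume \<phi>: "\<phi> \<in> P"
    \<comment> \<open>The root is sent to \<open>None\<close>: the row of an arc into the root has
      only its diagonal entry.\<close>
    define h where "h = (\<lambda>i. if head G (\<phi> i) \<in> e ` {0..<m} then Some (the_inv_into {0..<m} e (head G (\<phi> i))) else None)"
    have h: "h i = Some j \<longleftrightarrow> head G (\<phi> i) = e j" if "j < m" for i j
      using that by (auto simp: h_def the_inv_into_f_f[OF inj] inj_on_eq_iff[OF inj])
    define R where "R = (\<lambda>i. (e i, head G (\<phi> i))) ` {0..<m}"
    have "M \<phi> = mat m m (\<lambda>(i, j). of_bool (i = j) - of_bool (h i = Some j))"
      by (rule eq_matI) (auto simp: M_def h)
    hence "Determinant.det (M \<phi>) = of_bool (acyclic {(i, j). i < m \<and> j < m \<and> h i = Some j})"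
      by (simp only: det_id_minus_functional_graph)
    also have "{(i, j). i < m \<and> j < m \<and> h i = Some j} = {(i, j). i \<in> {0..<m} \<and> j \<in> {0..<m} \<and> (e i, e j) \<in> R}"
      using h inj by (auto simp: R_def dest: inj_onD)
    also have "acyclic \<dots> \<longleftrightarrow> acyclic R"
    proof (rule acyclic_pullback_insert_sink[OF inj])
      show "R \<subseteq> e ` {0..<m} \<times> insert \<rho> (e ` {0..<m})"
      proof -
        have "head G (\<phi> i) \<in> insert \<rho> (e ` {0..<m})" if "i < m" for i
          unfolding img using out[OF \<phi> that] by auto
        thus ?thesis unfolding R_def by (intro image_subsetI SigmaI imageI) simp_all
      qed
    qed (simp add: img)
    finally show "Determinant.det (M \<phi>) = of_bool (\<phi> \<in> Q)"
      using \<phi> by (simp add: Q_def R_def)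
  qed
  also have "\<dots> = of_nat (card Q)"
    using finP by (simp add: Q_def Int_def)
  \<comment> \<open>A tree is the range of a choice function, and its arcs have pairwise different
    tails, so the choice can be read off.\<close>
  also have "bij_betw (\<lambda>\<phi>. \<phi> ` {0..<m}) Q {F. directed_spanning_tree G \<rho> F}"
  proof (rule bij_betw_imageI)
    show "inj_on (\<lambda>\<phi>. \<phi> ` {0..<m}) Q"
    proof (rule inj_onI)
      fix \<phi> \<psi> assume \<phi>: "\<phi> \<in> Q" and \<psi>: "\<psi> \<in> Q" and eq: "\<phi> ` {0..<m} = \<psi> ` {0..<m}"
      hence P: "\<phi> \<in> P" "\<psi> \<in> P" by (auto simp: Q_def)
      show "\<phi> = \<psi>"
      proof (rule PiE_ext)
        fix i assume i: "i \<in> {0..<m}"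
        with eq have "\<phi> i \<in> \<psi> ` {0..<m}" by blast
        then obtain j where j: "j < m" "\<phi> i = \<psi> j" by auto
        with i have "e i = e j" using out[OF P(1), of i] out[OF P(2), of j] by auto
        with i j inj show "\<phi> i = \<psi> i" by (auto dest: inj_onD)
      qed (use P in \<open>auto simp: P_def\<close>)
    qed
    show "(\<lambda>\<phi>. \<phi> ` {0..<m}) ` Q = {F. directed_spanning_tree G \<rho> F}"
    proof (intro equalityI subsetI)
      fix F assume "F \<in> (\<lambda>\<phi>. \<phi> ` {0..<m}) ` Q"
      then obtain \<phi> where \<phi>: "\<phi> \<in> P" and ac: "acyclic ((\<lambda>i. (e i, head G (\<phi> i))) ` {0..<m})"
        and F: "F = \<phi> ` {0..<m}" by (auto simp: Q_def)
      have ends: "(\<lambda>a. (tail G a, head G a)) ` F = (\<lambda>i. (e i, head G (\<phi> i))) ` {0..<m}"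
        unfolding F image_image by (intro image_cong) (auto simp: out[OF \<phi>])
      have nroot: "e i \<noteq> \<rho>" if "i < m" for i using img that by auto
      have "\<exists>!a. a \<in> F \<and> tail G a = v" if v: "v \<in> verts G - {\<rho>}" for v
      proof -
        from v img obtain i where i: "i < m" "v = e i" by (metis atLeastLessThan_iff imageE)
        show ?thesis
        proof (rule ex1I[of _ "\<phi> i"])
          show "\<phi> i \<in> F \<and> tail G (\<phi> i) = v" using i out[OF \<phi>] by (auto simp: F)
          fix a assume "a \<in> F \<and> tail G a = v"
          then obtain j where "j < m" "a = \<phi> j" "tail G (\<phi> j) = e i" using i by (auto simp: F)
          thus "a = \<phi> i" using i inj out[OF \<phi>] by (auto dest: inj_onD)
        qed
      qed
      moreover have "F \<subseteq> arcs G" "\<forall>a\<in>F. tail G a \<noteq> \<rho>"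
        using nroot out[OF \<phi>] by (fastforce simp: F)+
      ultimately show "F \<in> {F. directed_spanning_tree G \<rho> F}"
        using ac by (simp add: directed_spanning_tree_iff[OF G \<rho>] ends)
    next
      fix F assume "F \<in> {F. directed_spanning_tree G \<rho> F}"
      hence F: "F \<subseteq> arcs G" "\<And>a. a \<in> F \<Longrightarrow> tail G a \<noteq> \<rho>"
        "\<And>v. v \<in> verts G - {\<rho>} \<Longrightarrow> \<exists>!a. a \<in> F \<and> tail G a = v"
        and ac: "acyclic ((\<lambda>a. (tail G a, head G a)) ` F)"
        by (auto simp: directed_spanning_tree_iff[OF G \<rho>])
      define \<phi> where "\<phi> = restrict (\<lambda>i. THE a. a \<in> F \<and> tail G a = e i) {0..<m}"
      have \<phi>: "\<phi> i \<in> F \<and> tail G (\<phi> i) = e i" if "i < m" for i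
      proof -
        have "e i \<in> verts G - {\<rho>}" using img that by auto
        from theI'[OF F(3)[OF this]] that show ?thesis by (simp add: \<phi>_def)
      qed
      have "\<phi> ` {0..<m} = F"
      proof (intro equalityI subsetI)
        fix a assume a: "a \<in> F"
        hence "tail G a \<in> verts G - {\<rho>}" using F by auto
        with img obtain i where i: "i < m" "tail G a = e i" by (metis atLeastLessThan_iff imageE)
        with F(3)[OF \<open>tail G a \<in> verts G - {\<rho>}\<close>] a \<phi>[OF i(1)] have "a = \<phi> i" by metis
        with i show "a \<in> \<phi> ` {0..<m}" by auto
      qed (use \<phi> in auto)
      moreover have "\<phi> \<in> P"
        unfolding P_def
      proof (rule PiE_I)
        fix i assume "i \<in> {0..<m}"
        thus "\<phi> i \<in> out_arcs G (e i)" using \<phi>[of i] F(1) by auto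
      qed (simp add: \<phi>_def)
      moreover have "(\<lambda>i. (e i, head G (\<phi> i))) ` {0..<m} = (\<lambda>a. (tail G a, head G a)) ` (\<phi> ` {0..<m})"
        unfolding image_image by (intro image_cong) (auto simp: \<phi>)
      ultimately show "F \<in> (\<lambda>\<phi>. \<phi> ` {0..<m}) ` Q"
        using ac by (auto simp: Q_def intro!: image_eqI[of _ _ \<phi>])
    qed
  qed
  hence "card Q = card {F. directed_spanning_tree G \<rho> F}" by (rule bij_betw_same_card)
  finally show ?thesis .
qed

section \<open>The triangle in Eisenstein coordinates\<close>

definition eisenstein :: "int \<times> int \<Rightarrow> complex" where
  "eisenstein = (\<lambda>(a, b). of_int a + of_int b * omega)"

text \<open>In the basis \<open>1\<close>, \<open>omega\<close> the corners are
  \<open>(0, 0)\<close>, \<open>(n, 0)\<close> and \<open>(n, n)\<close>, because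
  \<open>- n / omega = n + n * omega\<close>; each inequality is the open half-plane of one
  side.\<close>

definition alcove :: "nat \<Rightarrow> (int \<times> int) set" where
  "alcove n = {(a, b). 0 < b \<and> b < a \<and> a < int n}"

lemma omega_eq: "omega = Complex (- 1 / 2) (sqrt 3 / 2)"
proof -
  have "omega = cis (2 * pi / 3)" by (simp add: omega_def cis_conv_exp mult_ac)
  thus ?thesis by (simp add: complex_eq_iff cos_120 sin_120)
qed

lemma inverse_omega: "inverse omega = - 1 - omega"
proof (rule inverse_unique)
  show "omega * (- 1 - omega) = 1" by (simp add: omega_eq complex_eq_iff field_simps)
qed

lemma eisenstein_ints_eq: "eisenstein_ints = range eisenstein"
  by (auto simp: eisenstein_ints_def eisenstein_def image_iff)

lemma eisenstein_add: "eisenstein u + eisenstein v = eisenstein (u + v)"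
  by (cases u, cases v) (simp add: eisenstein_def algebra_simps)

lemma eisenstein_steps: "1 = eisenstein (1, 0)" "omega = eisenstein (0, 1)" "inverse omega = eisenstein (-1, -1)"
  by (simp_all add: eisenstein_def inverse_omega)

lemma triangle_eq:
  "triangle n = {z. 0 \<le> Im z} \<inter> {z. Im z \<le> sqrt 3 * Re z} \<inter> {z. sqrt 3 * Re z + Im z \<le> sqrt 3 * n}"
proof (intro equalityI subsetI)
  have third: "- of_nat n * inverse omega = Complex (n / 2) (n * sqrt 3 / 2)"
    unfolding inverse_omega omega_eq by (simp add: complex_eq_iff power_divide)
  fix z assume "z \<in> triangle n"
  then obtain u v w where uvw: "u \<ge> 0" "v \<ge> 0" "w \<ge> 0" "u + v + w = 1"
    and z: "z = u *\<^sub>R 0 + v *\<^sub>R of_nat n + w *\<^sub>R (- of_nat n * inverse omega)"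
    unfolding triangle_def convex_hull_3 by blast
  have reim: "Re z = v * n + w * (n / 2)" "Im z = w * (n * sqrt 3 / 2)"
    unfolding z third by simp_all
  have "v * n + w * n \<le> 1 * n"
    using uvw mult_right_mono[of "v + w" 1 "real n"] by (simp add: distrib_right)
  hence le: "sqrt 3 * (v * n + w * n) \<le> sqrt 3 * n" by (intro mult_left_mono) auto
  show "z \<in> {z. 0 \<le> Im z} \<inter> {z. Im z \<le> sqrt 3 * Re z} \<inter> {z. sqrt 3 * Re z + Im z \<le> sqrt 3 * n}"
  proof -
    have "0 \<le> v * (real n * sqrt 3)" "0 \<le> w * (real n * sqrt 3)" using uvw by simp_all
    with reim le show ?thesis by (simp add: algebra_simps)
  qed
next
  have third: "- of_nat n * inverse omega = Complex (n / 2) (n * sqrt 3 / 2)"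
    unfolding inverse_omega omega_eq by (simp add: complex_eq_iff power_divide)
  fix z assume "z \<in> {z. 0 \<le> Im z} \<inter> {z. Im z \<le> sqrt 3 * Re z} \<inter> {z. sqrt 3 * Re z + Im z \<le> sqrt 3 * n}"
  hence z: "0 \<le> Im z" "Im z \<le> sqrt 3 * Re z" "sqrt 3 * Re z + Im z \<le> sqrt 3 * n" by auto
  show "z \<in> triangle n"
  proof (cases "n = 0")
    case True
    hence "sqrt 3 * real n = 0" by simp
    with z have "Im z = 0" "sqrt 3 * Re z = 0" by linarith+
    hence "z = 0" by (simp add: complex_eq_iff)
    thus ?thesis unfolding triangle_def by (intro hull_inc) auto
  next
    case False
    \<comment> \<open>Barycentric weights of the corners \<open>- n / omega\<close> and
      \<open>n\<close>, solved from \<open>Im z\<close> and \<open>Re z\<close>. They divide by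
      \<open>n\<close>, so the degenerate triangle is treated apart.\<close>
    define w where "w = 2 * Im z / (sqrt 3 * n)"
    define v where "v = (sqrt 3 * Re z - Im z) / (sqrt 3 * n)"
    have nonneg: "w \<ge> 0" "v \<ge> 0" using z by (auto simp: w_def v_def)
    have "v + w = (sqrt 3 * Re z + Im z) / (sqrt 3 * n)" by (simp add: v_def w_def flip: add_divide_distrib)
    hence "v + w \<le> 1" using z(3) False by (simp only: divide_le_eq_1) simp
    hence rest: "1 - v - w \<ge> 0" by simp
    have eq: "z = (1 - v - w) *\<^sub>R 0 + v *\<^sub>R of_nat n + w *\<^sub>R (- of_nat n * inverse omega)"
      unfolding third using False by (simp add: complex_eq_iff v_def w_def field_simps)
    show ?thesis
      unfolding triangle_def convex_hull_3
      by (intro CollectI exI conjI, rule eq) (use nonneg rest in simp_all)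
  qed
qed

lemma closed_triangle: "closed (triangle n)"
  unfolding triangle_def by (intro compact_imp_closed compact_convex_hull) simp

text \<open>Interior commutes with finite intersections, and a half-plane with nonzero normal vector
  has the strict half-plane as its interior.\<close>

lemma interior_triangle:
  "interior (triangle n) = {z. 0 < Im z} \<inter> {z. Im z < sqrt 3 * Re z} \<inter> {z. sqrt 3 * Re z + Im z < sqrt 3 * n}"
proof -
  have 1: "{z. 0 \<le> Im z} = {z. \<i> \<bullet> z \<ge> 0}" "{z. 0 < Im z} = {z. \<i> \<bullet> z > 0}"
    by (auto simp: inner_complex_def)
  have 2: "{z. Im z \<le> sqrt 3 * Re z} = {z. Complex (sqrt 3) (-1) \<bullet> z \<ge> 0}"
    "{z. Im z < sqrt 3 * Re z} = {z. Complex (sqrt 3) (-1) \<bullet> z > 0}"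
    by (auto simp: inner_complex_def)
  have 3: "{z. sqrt 3 * Re z + Im z \<le> sqrt 3 * n} = {z. Complex (sqrt 3) 1 \<bullet> z \<le> sqrt 3 * n}"
    "{z. sqrt 3 * Re z + Im z < sqrt 3 * n} = {z. Complex (sqrt 3) 1 \<bullet> z < sqrt 3 * n}"
    by (auto simp: inner_complex_def)
  have "interior {z. \<i> \<bullet> z \<ge> 0} = {z. \<i> \<bullet> z > 0}"
    "interior {z. Complex (sqrt 3) (-1) \<bullet> z \<ge> 0} = {z. Complex (sqrt 3) (-1) \<bullet> z > 0}"
    "interior {z. Complex (sqrt 3) 1 \<bullet> z \<le> sqrt 3 * n} = {z. Complex (sqrt 3) 1 \<bullet> z < sqrt 3 * n}"
    by (intro interior_halfspace_ge interior_halfspace_le; simp add: complex_eq_iff)+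
  thus ?thesis
    unfolding triangle_eq interior_Int 1 2 3 by simp
qed

lemma Re_eisenstein: "Re (eisenstein (a, b)) = a - b / 2"
  and Im_eisenstein: "Im (eisenstein (a, b)) = sqrt 3 * (b / 2)"
  by (simp_all add: eisenstein_def omega_eq)

lemma inj_eisenstein: "inj eisenstein"
proof (rule injI)
  fix u v assume "eisenstein u = eisenstein v"
  hence "Re (eisenstein u) = Re (eisenstein v)" "Im (eisenstein u) = Im (eisenstein v)" by simp_all
  thus "u = v" by (cases u, cases v) (simp add: Re_eisenstein Im_eisenstein)
qed

lemma eisenstein_in_triangle:
  "eisenstein (a, b) \<in> triangle n \<longleftrightarrow> 0 \<le> b \<and> b \<le> a \<and> a \<le> int n"
  "eisenstein (a, b) \<in> interior (triangle n) \<longleftrightarrow> (a, b) \<in> alcove n"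
proof -
  have le: "sqrt 3 * x \<le> sqrt 3 * y \<longleftrightarrow> x \<le> y" and less: "sqrt 3 * x < sqrt 3 * y \<longleftrightarrow> x < y" for x y :: real
    by simp_all
  have sum: "sqrt 3 * (a - b / 2) + sqrt 3 * (b / 2) = sqrt 3 * real_of_int a"
    by (simp add: algebra_simps)
  show "eisenstein (a, b) \<in> triangle n \<longleftrightarrow> 0 \<le> b \<and> b \<le> a \<and> a \<le> int n"
    unfolding triangle_eq Int_iff mem_Collect_eq Re_eisenstein Im_eisenstein sum le
    by (auto simp: zero_le_mult_iff)
  show "eisenstein (a, b) \<in> interior (triangle n) \<longleftrightarrow> (a, b) \<in> alcove n"
    unfolding interior_triangle Int_iff mem_Collect_eq Re_eisenstein Im_eisenstein sum less alcove_def
    by (auto simp: zero_less_mult_iff)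
qed

lemma interior_points_eq: "interior_points n = eisenstein ` alcove n"
  unfolding interior_points_def eisenstein_ints_eq using eisenstein_in_triangle(2) by auto

text \<open>Each step changes the positive integers \<open>b\<close>, \<open>a - b\<close> and
  \<open>n - a\<close> by at most one, so they stay nonnegative: a step cannot jump over a
  side.\<close>

lemma neighbour_in_frontier_iff:
  assumes "u \<in> alcove n" "d \<in> {(1, 0), (0, 1), (-1, -1)}"
  shows "eisenstein (u + d) \<in> frontier (triangle n) \<longleftrightarrow> u + d \<notin> alcove n"
proof -
  obtain a b where u: "u = (a, b)" by fastforce
  have "eisenstein (u + d) \<in> triangle n"
    using assms by (auto simp: u eisenstein_in_triangle alcove_def)
  moreover have "eisenstein (u + d) \<in> interior (triangle n) \<longleftrightarrow> u + d \<in> alcove n"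
    using eisenstein_in_triangle(2) by (cases "u + d") simp
  ultimately show ?thesis by (simp add: frontier_def closure_closed[OF closed_triangle])
qed

lemma finite_alcove: "finite (alcove n)"
  by (rule finite_subset[of _ "{0..int n} \<times> {0..int n}"]) (auto simp: alcove_def)

section \<open>Roots of unity and the parametrization of the eigenvalues\<close>

definition unit_root :: "nat \<Rightarrow> int \<Rightarrow> complex" where
  "unit_root m k = cis (2 * pi * k / m)"

lemma unit_root_add: "unit_root m (j + k) = unit_root m j * unit_root m k"
  by (simp add: unit_root_def cis_mult add_divide_distrib distrib_left)

lemma unit_root_0: "unit_root m 0 = 1"
  by (simp add: unit_root_def)

lemma cnj_unit_root: "cnj (unit_root m k) = unit_root m (- k)"
  by (simp add: unit_root_def cis_cnj)

lemma unit_root_nonzero: "unit_root m k \<noteq> 0"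
  by (simp add: unit_root_def)

lemma unit_root_powi: "unit_root m k powi a = unit_root m (k * a)"
  by (simp add: unit_root_def cis_power_int mult_ac)

lemma unit_root_power: "unit_root m k ^ a = unit_root m (k * int a)"
  using unit_root_powi[of m k "int a"] by simp

lemma unit_root_mult_left: "c > 0 \<Longrightarrow> unit_root (c * m) (int c * k) = unit_root m k"
  by (simp add: unit_root_def mult.left_commute[of _ "real c"])

lemma unit_root_multiple: "m > 0 \<Longrightarrow> unit_root m (int m * q) = 1"
proof -
  assume "m > 0"
  hence "unit_root m (int m * q) = cis (2 * pi * of_int q)" by (simp add: unit_root_def field_simps)
  thus ?thesis by (simp add: cis_multiple_2pi)
qed

lemma unit_root_mod: "m > 0 \<Longrightarrow> unit_root m k = unit_root m (k mod int m)"
  using unit_root_add[of m "int m * (k div int m)" "k mod int m"]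
  by (simp add: unit_root_multiple)

lemma bij_betw_unit_root: "m > 0 \<Longrightarrow> bij_betw (\<lambda>k. unit_root m (int k)) {..<m} {z. z ^ m = 1}"
  using Complex.bij_betw_roots_unity[of m] by (simp add: unit_root_def)

lemma unit_root_eq_1_iff:
  assumes m: "m > 0"
  shows "unit_root m k = 1 \<longleftrightarrow> int m dvd k"
proof
  assume "unit_root m k = 1"
  hence "unit_root m (int (nat (k mod int m))) = unit_root m (int 0)"
    using m unit_root_mod[OF m, of k] by (simp add: unit_root_0)
  moreover have "nat (k mod int m) < m" using m by (simp add: nat_less_iff)
  ultimately have "nat (k mod int m) = 0"
    using inj_onD[OF bij_betw_imp_inj_on[OF bij_betw_unit_root[OF m]], of "nat (k mod int m)" 0] m by simp
  hence "k mod int m = 0" using m by (simp add: nat_eq_iff)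
  thus "int m dvd k" by auto
next
  assume "int m dvd k"
  thus "unit_root m k = 1" using m by (auto elim!: dvdE simp: unit_root_multiple)
qed

lemma unit_root_eq_iff:
  assumes m: "m > 0"
  shows "unit_root m j = unit_root m k \<longleftrightarrow> int m dvd j - k"
proof -
  have "unit_root m j = unit_root m (j - k) * unit_root m k"
    by (simp flip: unit_root_add)
  thus ?thesis using unit_root_eq_1_iff[OF m, of "j - k"] by (auto simp: unit_root_nonzero)
qed

text \<open>Orthogonality of the characters of the cyclic group of order \<open>m\<close>, by the
  geometric series.\<close>

lemma sum_unit_root:
  assumes m: "m > 0"
  shows "(\<Sum>i<m. unit_root m (int i * k)) = (if int m dvd k then of_nat m else 0)"
proof (cases "int m dvd k")
  case True
  hence "unit_root m (int i * k) = 1" for i by (simp add: unit_root_eq_1_iff[OF m])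
  thus ?thesis using True by simp
next
  case False
  have "(\<Sum>i<m. unit_root m (int i * k)) = (\<Sum>i<m. unit_root m k ^ i)"
    by (simp add: unit_root_power mult.commute)
  also have "\<dots> = (unit_root m k ^ m - 1) / (unit_root m k - 1)"
    by (rule geometric_sum) (simp add: unit_root_eq_1_iff[OF m] False)
  also have "unit_root m k ^ m = 1"
    by (simp add: unit_root_power unit_root_eq_1_iff[OF m])
  finally show ?thesis using False by simp
qed

text \<open>For \<open>u\<close> in the alcove the weights are congruent modulo 3, sum to 0 and satisfy
  \<open>w\<^sub>0 < w\<^sub>1 < w\<^sub>2 < w\<^sub>0 + 3 n\<close>. Each set \<open>{\<alpha>, \<beta>, \<gamma>}\<close> of eigenvalue data has exactly one such
  system of exponents of \<open>exp (2 \<pi> \<i> / (3 n))\<close>: the cyclic order of the three numbers leaves a shift by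
  multiples of \<open>n\<close>, which the vanishing of the sum fixes.\<close>

definition weight :: "int \<times> int \<Rightarrow> nat \<Rightarrow> int" where
  "weight = (\<lambda>(a, b) i. if i = 0 then b - 2 * a else if i = 1 then a - 2 * b else a + b)"

text \<open>A permutation of three indices is represented by its first two values.\<close>

definition index_pairs :: "(nat \<times> nat) set" where
  "index_pairs = {(0, 1), (1, 0), (1, 2), (2, 1), (2, 0), (0, 2)}"

text \<open>The third exponent is the remaining weight, because the three weights sum to
  zero.\<close>

definition weight_triple :: "nat \<Rightarrow> (int \<times> int) \<times> nat \<times> nat \<Rightarrow> complex \<times> complex \<times> complex" where
  "weight_triple n = (\<lambda>(u, i, j). (unit_root (3 * n) (weight u i), unit_root (3 * n) (weight u j),
     unit_root (3 * n) (- weight u i - weight u j)))"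

section \<open>Alcove points with orderings against eigenvalue triples\<close>

text \<open>Uniqueness of the exponents. Differences of two weights are smaller than
  \<open>3 * n\<close> in absolute value, so the multiples of \<open>3 * n\<close> that could
  separate the two systems satisfy three inequalities whose only integer solution is
  \<open>x = y = 0\<close>.\<close>

lemma weight_eq_of_cong:
  assumes n: "n > 0" and u: "u \<in> alcove n" "v \<in> alcove n"
    and ij: "(i, j) \<in> index_pairs" "(k, l) \<in> index_pairs"
    and cong: "int (3 * n) dvd weight u i - weight v k" "int (3 * n) dvd weight u j - weight v l"
  shows "(u, i, j) = (v, k, l)"
proof -
  obtain a b where ab: "u = (a, b)" "0 < b" "b < a" "a < int n" using u by (auto simp: alcove_def)
  obtain c d where cd: "v = (c, d)" "0 < d" "d < c" "c < int n" using u by (auto simp: alcove_def)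
  from cong obtain x y where xy: "weight u i - weight v k = int (3 * n) * x"
    "weight u j - weight v l = int (3 * n) * y" by (auto elim!: dvdE)
  define N where "N = int (3 * n)"
  have N: "N > 0" using n by (simp add: N_def)
  \<comment> \<open>With the third weight equal to \<open>- weight w i - weight w j\<close>, these
    are the three pairwise differences of the weights.\<close>
  have spread: "\<bar>weight w i - weight w j\<bar> < N \<and> \<bar>2 * weight w i + weight w j\<bar> < N \<and>
      \<bar>weight w i + 2 * weight w j\<bar> < N" if "w \<in> alcove n" "(i, j) \<in> index_pairs" for w i j
    using that by (auto simp: index_pairs_def weight_def alcove_def N_def)
  have diff_bound: "\<bar>p - q\<bar> < N * 2" if "\<bar>p\<bar> < N" "\<bar>q\<bar> < N" for p q
    using that by linarith
  have "N * (x - y) = (weight u i - weight u j) - (weight v k - weight v l)"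
    "N * (2 * x + y) = (2 * weight u i + weight u j) - (2 * weight v k + weight v l)"
    "N * (x + 2 * y) = (weight u i + 2 * weight u j) - (weight v k + 2 * weight v l)"
    using xy[folded N_def] by (simp_all add: right_diff_distrib distrib_left)
  hence "\<bar>N * (x - y)\<bar> < N * 2" "\<bar>N * (2 * x + y)\<bar> < N * 2" "\<bar>N * (x + 2 * y)\<bar> < N * 2"
    using spread[OF u(1) ij(1)] spread[OF u(2) ij(2)] by (simp_all only: diff_bound)
  hence "\<bar>x - y\<bar> < 2" "\<bar>2 * x + y\<bar> < 2" "\<bar>x + 2 * y\<bar> < 2"
    unfolding abs_mult using N by simp_all
  hence "x = 0" "y = 0" by linarith+
  hence eq: "weight u i = weight v k" "weight u j = weight v l" using xy by simp_all
  show ?thesis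
    using eq ij ab cd by (auto simp: index_pairs_def weight_def)
qed

text \<open>The sum lies strictly between \<open>0\<close> and \<open>3 * N\<close>. Hence one or
  two of the residues have to be lowered by \<open>N\<close> to reach sum zero.\<close>

lemma cyclic_shift_sum_zero:
  fixes x y z N :: int
  assumes "0 \<le> x" "x < y" "y < z" "z < N" "N dvd x + y + z"
  obtains "x + y + z = N" | "x + y + z = 2 * N"
proof -
  from assms obtain k where k: "x + y + z = N * k" by (auto elim!: dvdE)
  have "N > 0" using assms by linarith
  have "N * 0 < N * k" "N * k < N * 3" using assms k by linarith+
  hence "0 < k" "k < 3" using \<open>N > 0\<close> by (simp_all only: mult_less_cancel_left_pos)
  hence "k = 1 \<or> k = 2" by linarith
  thus ?thesis using k that by auto
qed

text \<open>Lowering the one or two largest residues by \<open>3 * n\<close> makes the sum zero and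
  just rotates the cyclic order. The gaps of the new increasing sequence are
  \<open>3 * (a - b)\<close> and \<open>3 * b\<close>, which determines the alcove point
  \<open>(a, b)\<close>.\<close>

lemma exists_alcove_sorted:
  assumes "0 \<le> x" "x < y" "y < z" "z < int (3 * n)" "int (3 * n) dvd x + y + z"
    and "3 dvd y - x" "3 dvd z - y"
  obtains u where "u \<in> alcove n"
    "{(weight u 0, z), (weight u 1, x), (weight u 2, y)} \<subseteq> {(j, k). int (3 * n) dvd j - k} \<or>
     {(weight u 0, y), (weight u 1, z), (weight u 2, x)} \<subseteq> {(j, k). int (3 * n) dvd j - k}"
proof -
  from assms(6,7) obtain s t where st: "y = x + 3 * s" "z = y + 3 * t"
    by (metis add.commute diff_add_cancel dvdE)
  from assms(1-5) show ?thesis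
  proof (cases rule: cyclic_shift_sum_zero)
    case 1
    \<comment> \<open>The increasing sequence is \<open>z - 3 * n\<close>, \<open>x\<close>,
      \<open>y\<close>, so \<open>b = s\<close> and \<open>a - b = n - s - t\<close>.\<close>
    have "(int n - t, s) \<in> alcove n"
      using assms(1-4) st by (auto simp: alcove_def)
    moreover have "weight (int n - t, s) 0 = z - int (3 * n)" "weight (int n - t, s) 1 = x" "weight (int n - t, s) 2 = y"
      using 1 st by (simp_all add: weight_def)
    ultimately show ?thesis by (intro that[of "(int n - t, s)"]) simp_all
  next
    case 2
    \<comment> \<open>Here it is \<open>y - 3 * n\<close>, \<open>z - 3 * n\<close>,
      \<open>x\<close>, so \<open>a - b = t\<close> and \<open>b = n - s - t\<close>.\<close>
    have "(int n - s, int n - s - t) \<in> alcove n"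
      using assms(1-4) st by (auto simp: alcove_def)
    moreover have "weight (int n - s, int n - s - t) 0 = y - int (3 * n)"
      "weight (int n - s, int n - s - t) 1 = z - int (3 * n)" "weight (int n - s, int n - s - t) 2 = x"
      using 2 st by (simp_all add: weight_def)
    ultimately show ?thesis by (intro that[of "(int n - s, int n - s - t)"]) simp_all
  qed
qed

text \<open>Sorting reduces to the increasing case; the index pair records where sorting and
  rotation put \<open>x\<close> and \<open>y\<close>.\<close>

lemma exists_alcove:
  assumes "{x, y, z} \<subseteq> {0..<int (3 * n)}" "int (3 * n) dvd x + y + z"
    and "x \<noteq> y" "y \<noteq> z" "x \<noteq> z" "3 dvd y - x" "3 dvd z - y"
  obtains u i j where "u \<in> alcove n" "(i, j) \<in> index_pairs"
    "int (3 * n) dvd weight u i - x" "int (3 * n) dvd weight u j - y"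
proof -
  have dvd: "int (3 * n) dvd x + z + y" "int (3 * n) dvd y + x + z" "int (3 * n) dvd y + z + x"
    "int (3 * n) dvd z + x + y" "int (3 * n) dvd z + y + x"
    using assms(2) by (simp_all add: ac_simps)
  have three: "3 dvd x - y" "3 dvd y - z" "3 dvd z - x" "3 dvd x - z"
    using assms(6,7) by presburger+
  note intros = that[of _ 0 1] that[of _ 1 0] that[of _ 0 2] that[of _ 2 0] that[of _ 1 2] that[of _ 2 1]
  consider "x < y" "y < z" | "x < z" "z < y" | "y < x" "x < z" | "y < z" "z < x" | "z < x" "x < y" | "z < y" "y < x"
    using assms(3-5) by linarith
  thus ?thesis
  proof cases
    case 1
    with exists_alcove_sorted[of x y z n] assms obtain u where "u \<in> alcove n"
      "{(weight u 0, z), (weight u 1, x), (weight u 2, y)} \<subseteq> {(j, k). int (3 * n) dvd j - k} \<or>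
       {(weight u 0, y), (weight u 1, z), (weight u 2, x)} \<subseteq> {(j, k). int (3 * n) dvd j - k}" by auto
    thus ?thesis by (auto simp: index_pairs_def intro: intros)
  next
    case 2
    with exists_alcove_sorted[of x z y n] assms dvd three obtain u where "u \<in> alcove n"
      "{(weight u 0, y), (weight u 1, x), (weight u 2, z)} \<subseteq> {(j, k). int (3 * n) dvd j - k} \<or>
       {(weight u 0, z), (weight u 1, y), (weight u 2, x)} \<subseteq> {(j, k). int (3 * n) dvd j - k}" by auto
    thus ?thesis by (auto simp: index_pairs_def intro: intros)
  next
    case 3
    with exists_alcove_sorted[of y x z n] assms dvd three obtain u where "u \<in> alcove n"
      "{(weight u 0, z), (weight u 1, y), (weight u 2, x)} \<subseteq> {(j, k). int (3 * n) dvd j - k} \<or>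
       {(weight u 0, x), (weight u 1, z), (weight u 2, y)} \<subseteq> {(j, k). int (3 * n) dvd j - k}" by auto
    thus ?thesis by (auto simp: index_pairs_def intro: intros)
  next
    case 4
    with exists_alcove_sorted[of y z x n] assms dvd three obtain u where "u \<in> alcove n"
      "{(weight u 0, x), (weight u 1, y), (weight u 2, z)} \<subseteq> {(j, k). int (3 * n) dvd j - k} \<or>
       {(weight u 0, z), (weight u 1, x), (weight u 2, y)} \<subseteq> {(j, k). int (3 * n) dvd j - k}" by auto
    thus ?thesis by (auto simp: index_pairs_def intro: intros)
  next
    case 5
    with exists_alcove_sorted[of z x y n] assms dvd three obtain u where "u \<in> alcove n"
      "{(weight u 0, y), (weight u 1, z), (weight u 2, x)} \<subseteq> {(j, k). int (3 * n) dvd j - k} \<or>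
       {(weight u 0, x), (weight u 1, y), (weight u 2, z)} \<subseteq> {(j, k). int (3 * n) dvd j - k}" by auto
    thus ?thesis by (auto simp: index_pairs_def intro: intros)
  next
    case 6
    with exists_alcove_sorted[of z y x n] assms dvd three obtain u where "u \<in> alcove n"
      "{(weight u 0, x), (weight u 1, z), (weight u 2, y)} \<subseteq> {(j, k). int (3 * n) dvd j - k} \<or>
       {(weight u 0, y), (weight u 1, x), (weight u 2, z)} \<subseteq> {(j, k). int (3 * n) dvd j - k}" by auto
    thus ?thesis by (auto simp: index_pairs_def intro: intros)
  qed
qed

lemma weight_sum: "weight u 0 + weight u 1 + weight u 2 = 0"
  by (cases u) (simp add: weight_def)

text \<open>In terms of exponents modulo \<open>3 * n\<close>, the conditions on a triple say that
  the exponents are distinct, congruent modulo 3 and of sum zero. The weights represent such systems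
  uniquely, and the six index pairs give the orderings.\<close>

lemma bij_betw_weight_triple:
  assumes n: "n > 0"
  shows "bij_betw (weight_triple n) (alcove n \<times> index_pairs) (eigen_triples n)"
proof (rule bij_betw_imageI)
  have n3: "3 * n > 0" using n by simp
  show "inj_on (weight_triple n) (alcove n \<times> index_pairs)"
  proof (rule inj_onI)
    fix p q
    assume pq: "p \<in> alcove n \<times> index_pairs" "q \<in> alcove n \<times> index_pairs"
      and eq: "weight_triple n p = weight_triple n q"
    obtain u i j v k l where uv: "p = (u, i, j)" "q = (v, k, l)" by (metis prod.exhaust)
    show "p = q"
      unfolding uv using pq eq
      by (intro weight_eq_of_cong[OF n]) (simp_all add: uv weight_triple_def unit_root_eq_iff[OF n3])
  qed
  show "weight_triple n ` (alcove n \<times> index_pairs) = eigen_triples n"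
  proof (intro equalityI subsetI)
    fix t assume "t \<in> weight_triple n ` (alcove n \<times> index_pairs)"
    then obtain a b i j where ab: "0 < b" "b < a" "a < int n" and ij: "(i, j) \<in> index_pairs"
      and t: "t = weight_triple n ((a, b), i, j)" by (auto simp: alcove_def)
    have "int (3 * n) dvd weight (a, b) i * int (3 * n)" by simp
    moreover have "3 dvd weight (a, b) i - weight (a, b) j"
      using ij by (auto simp: index_pairs_def weight_def)
    hence "int (3 * n) dvd (weight (a, b) i - weight (a, b) j) * int n"
      by (simp add: mult_dvd_mono)
    moreover have ndvd: "\<not> int (3 * n) dvd d" if "d \<noteq> 0" "\<bar>d\<bar> < int (3 * n)" for d
      using that dvd_imp_le_int[of d "int (3 * n)"] by auto
    have "\<not> int (3 * n) dvd weight (a, b) i - weight (a, b) j"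
      "\<not> int (3 * n) dvd weight (a, b) j - (- weight (a, b) i - weight (a, b) j)"
      "\<not> int (3 * n) dvd weight (a, b) i - (- weight (a, b) i - weight (a, b) j)"
      by (rule ndvd; use ij ab in \<open>auto simp: index_pairs_def weight_def\<close>)+
    moreover have "unit_root (3 * n) j / unit_root (3 * n) k = unit_root (3 * n) (j - k)" for j k
      using unit_root_add[of "3 * n" "j - k" k] by (simp add: unit_root_nonzero field_simps)
    ultimately show "t \<in> eigen_triples n"
      unfolding t weight_triple_def eigen_triples_def
      by (simp add: unit_root_power unit_root_eq_1_iff[OF n3] unit_root_eq_iff[OF n3] unit_root_0 flip: unit_root_add)
  next
    fix t assume "t \<in> eigen_triples n"
    then obtain \<alpha> \<beta> \<gamma> where t: "t = (\<alpha>, \<beta>, \<gamma>)" and prod: "\<alpha> * \<beta> * \<gamma> = 1" and \<alpha>: "\<alpha> ^ (3 * n) = 1"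
      and div: "(\<alpha> / \<beta>) ^ n = 1" and dist: "\<alpha> \<noteq> \<beta>" "\<beta> \<noteq> \<gamma>" "\<alpha> \<noteq> \<gamma>"
      by (auto simp: eigen_triples_def)
    have nz: "\<alpha> \<noteq> 0" "\<beta> \<noteq> 0" "\<gamma> \<noteq> 0" using prod by auto
    have "\<alpha> ^ n = \<beta> ^ n" using div nz by (simp add: power_divide)
    hence \<beta>: "\<beta> ^ (3 * n) = 1" using \<alpha> by (metis mult.commute power_mult)
    have "(\<alpha> * \<beta> * \<gamma>) ^ (3 * n) = 1" using prod by simp
    hence \<gamma>: "\<gamma> ^ (3 * n) = 1" using \<alpha> \<beta> by (simp add: power_mult_distrib)
    have root: "\<exists>x\<in>{0..<int (3 * n)}. w = unit_root (3 * n) x" if "w ^ (3 * n) = 1" for w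
    proof -
      from that have "w \<in> (\<lambda>k. unit_root (3 * n) (int k)) ` {..<3 * n}"
        using bij_betw_imp_surj_on[OF bij_betw_unit_root[OF n3]] by simp
      then obtain k where "k < 3 * n" "w = unit_root (3 * n) (int k)" by auto
      thus ?thesis by (intro bexI[of _ "int k"]) auto
    qed
    from root[OF \<alpha>] root[OF \<beta>] root[OF \<gamma>] obtain x y z where
      xyz: "{x, y, z} \<subseteq> {0..<int (3 * n)}" "\<alpha> = unit_root (3 * n) x" "\<beta> = unit_root (3 * n) y" "\<gamma> = unit_root (3 * n) z"
      by (metis empty_subsetI insert_subset)
    have sum: "int (3 * n) dvd x + y + z"
      using prod unfolding xyz unit_root_add[symmetric] by (simp add: unit_root_eq_1_iff[OF n3])
    have "int (3 * n) dvd x * int n - y * int n"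
      using \<open>\<alpha> ^ n = \<beta> ^ n\<close> unfolding xyz unit_root_power by (simp only: unit_root_eq_iff[OF n3])
    hence "3 * int n dvd (x - y) * int n" by (simp add: algebra_simps)
    hence xy: "3 dvd x - y" using n by simp
    \<comment> \<open>Since \<open>x\<close> and \<open>y\<close> agree modulo 3, the zero sum
      forces \<open>z\<close> to agree with them: \<open>z = - 2 * x = x\<close> modulo 3.\<close>
    have "3 dvd x + y + z" using sum by (metis dvd_mult_left of_nat_mult of_nat_numeral)
    with xy have "3 dvd y - x" "3 dvd z - y" by presburger+
    with exists_alcove[of x y z n] xyz sum dist obtain u i j where
      u: "u \<in> alcove n" "(i, j) \<in> index_pairs" "int (3 * n) dvd weight u i - x" "int (3 * n) dvd weight u j - y"
      by metis
    have ab: "unit_root (3 * n) (weight u i) = \<alpha>" "unit_root (3 * n) (weight u j) = \<beta>"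
      using u xyz by (simp_all add: unit_root_eq_iff[OF n3])
    have "\<alpha> * \<beta> * unit_root (3 * n) (- weight u i - weight u j) = 1"
      unfolding ab[symmetric] unit_root_add[symmetric] by (simp add: unit_root_0)
    hence "\<alpha> * \<beta> * unit_root (3 * n) (- weight u i - weight u j) = \<alpha> * \<beta> * \<gamma>"
      using prod by simp
    hence "unit_root (3 * n) (- weight u i - weight u j) = \<gamma>" using nz by simp
    with ab have "t = weight_triple n (u, i, j)" by (simp add: t weight_triple_def)
    with u show "t \<in> weight_triple n ` (alcove n \<times> index_pairs)" by blast
  qed
qed

section \<open>Antisymmetric eigenvectors\<close>

text \<open>The determinant of the matrix with rows \<open>(\<alpha>\<^sup>x, \<beta>\<^sup>x, \<gamma>\<^sup>x)\<close> for \<open>x = a, b, 0\<close>.\<close>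

definition wave :: "complex \<times> complex \<times> complex \<Rightarrow> int \<times> int \<Rightarrow> complex" where
  "wave = (\<lambda>(\<alpha>, \<beta>, \<gamma>) (a, b).
     \<alpha> powi a * \<beta> powi b - \<beta> powi a * \<alpha> powi b + \<beta> powi a * \<gamma> powi b -
     \<gamma> powi a * \<beta> powi b + \<gamma> powi a * \<alpha> powi b - \<alpha> powi a * \<gamma> powi b)"

text \<open>The step by \<open>inverse omega\<close> lowers both exponents, which divides by
  \<open>x * y\<close>, that is, multiplies by \<open>z\<close>.\<close>

lemma powi_pred_mult_powi_pred:
  fixes x y z :: complex
  assumes "x * y * z = 1"
  shows "x powi (a - 1) * y powi (b - 1) = x powi a * y powi b * z"
proof -
  have nz: "x \<noteq> 0" "y \<noteq> 0" using assms by auto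
  have "z = 1 / (x * y)" using assms nz by (simp add: field_simps)
  thus ?thesis using nz by (simp add: power_int_diff)
qed

text \<open>Under the three steps each of the six monomials is multiplied by the three numbers in
  some order, so all of them have the same eigenvalue, and so does their signed sum.\<close>

lemma wave_hop:
  assumes "\<alpha> * \<beta> * \<gamma> = 1"
  shows "wave (\<alpha>, \<beta>, \<gamma>) (a + 1, b) + wave (\<alpha>, \<beta>, \<gamma>) (a, b + 1) + wave (\<alpha>, \<beta>, \<gamma>) (a - 1, b - 1)
    = (\<alpha> + \<beta> + \<gamma>) * wave (\<alpha>, \<beta>, \<gamma>) (a, b)"
proof -
  have perm: "\<alpha> * \<gamma> * \<beta> = 1" "\<beta> * \<alpha> * \<gamma> = 1" "\<beta> * \<gamma> * \<alpha> = 1" "\<gamma> * \<alpha> * \<beta> = 1" "\<gamma> * \<beta> * \<alpha> = 1"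
    using assms by (simp_all add: ac_simps)
  note pred_eq = powi_pred_mult_powi_pred[OF assms] perm[THEN powi_pred_mult_powi_pred]
  have "\<alpha> \<noteq> 0" "\<beta> \<noteq> 0" "\<gamma> \<noteq> 0" using assms by auto
  hence succ_eq: "x powi (k + 1) = x powi k * x" if "x \<in> {\<alpha>, \<beta>, \<gamma>}" for x k
    using that by (auto intro: power_int_add_1)
  show ?thesis
    unfolding wave_def prod.case pred_eq succ_eq[of \<alpha>, simplified] succ_eq[of \<beta>, simplified] succ_eq[of \<gamma>, simplified]
    by (simp add: algebra_simps)
qed

text \<open>As a determinant: for \<open>b = 0\<close> and for \<open>a = b\<close> two rows
  coincide, and for \<open>a = n\<close> the first row is constant, hence proportional to the row of
  exponent 0.\<close>

lemma wave_boundary: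
  assumes "\<alpha> powi n = \<beta> powi n" "\<beta> powi n = \<gamma> powi n"
  shows "wave (\<alpha>, \<beta>, \<gamma>) (a, 0) = 0" "wave (\<alpha>, \<beta>, \<gamma>) (a, a) = 0" "wave (\<alpha>, \<beta>, \<gamma>) (n, b) = 0"
  using assms by (simp_all add: wave_def)

text \<open>The determinant has two equal columns.\<close>

lemma wave_not_distinct: "\<not> (\<alpha> \<noteq> \<beta> \<and> \<beta> \<noteq> \<gamma> \<and> \<alpha> \<noteq> \<gamma>) \<Longrightarrow> wave (\<alpha>, \<beta>, \<gamma>) v = 0"
  by (cases v) (auto simp: wave_def)

text \<open>A step that leaves the alcove lands on a side, where the wave vanishes; so the cut-off
  at the boundary changes nothing and the hop relation of the whole lattice applies.\<close>

lemma wave_sum_steps: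
  assumes "\<alpha> * \<beta> * \<gamma> = 1" "\<alpha> ^ n = \<beta> ^ n" "\<beta> ^ n = \<gamma> ^ n" and v: "v \<in> alcove n"
  shows "(\<Sum>d\<in>{(1, 0), (0, 1), (-1, -1)}. if v + d \<in> alcove n then wave (\<alpha>, \<beta>, \<gamma>) (v + d) else 0) =
    (\<alpha> + \<beta> + \<gamma>) * wave (\<alpha>, \<beta>, \<gamma>) v"
proof -
  obtain a b where ab: "v = (a, b)" "0 < b" "b < a" "a < int n" using v by (auto simp: alcove_def)
  note boundary = wave_boundary[of \<alpha> "int n" \<beta> \<gamma>, unfolded power_int_of_nat, OF assms(2,3)]
  have "(if v + d \<in> alcove n then wave (\<alpha>, \<beta>, \<gamma>) (v + d) else 0) = wave (\<alpha>, \<beta>, \<gamma>) (v + d)"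
    if d: "d \<in> {(1, 0), (0, 1), (-1, -1)}" for d
  proof (cases "v + d \<in> alcove n")
    case False
    obtain c e where ce: "v + d = (c, e)" by fastforce
    with False d ab have "e = 0 \<or> c = e \<or> c = int n" by (auto simp: alcove_def)
    thus ?thesis using boundary False ce by auto
  qed simp
  hence "(\<Sum>d\<in>{(1, 0), (0, 1), (-1, -1)}. if v + d \<in> alcove n then wave (\<alpha>, \<beta>, \<gamma>) (v + d) else 0) =
      (\<Sum>d\<in>{(1, 0), (0, 1), (-1, -1)}. wave (\<alpha>, \<beta>, \<gamma>) (v + d))"
    by (intro sum.cong) auto
  also have "\<dots> = wave (\<alpha>, \<beta>, \<gamma>) (a + 1, b) + wave (\<alpha>, \<beta>, \<gamma>) (a, b + 1) + wave (\<alpha>, \<beta>, \<gamma>) (a - 1, b - 1)"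
    by (simp add: ab(1))
  finally show ?thesis by (simp add: wave_hop[OF assms(1)] ab(1))
qed

section \<open>The group of all triples and its characters\<close>

definition group_triple :: "nat \<Rightarrow> nat \<times> nat \<Rightarrow> complex \<times> complex \<times> complex" where
  "group_triple n = (\<lambda>(i, j). (unit_root (3 * n) (int i), unit_root (3 * n) (int i + 3 * int j),
     unit_root (3 * n) (- 2 * int i - 3 * int j)))"

lemma bij_betw_group_triple:
  assumes n: "n > 0"
  shows "bij_betw (group_triple n) ({..<3 * n} \<times> {..<n})
    {(\<alpha>, \<beta>, \<gamma>). \<alpha> * \<beta> * \<gamma> = 1 \<and> \<alpha> ^ (3 * n) = 1 \<and> (\<alpha> / \<beta>) ^ n = 1}"
proof (rule bij_betw_imageI)
  have n3: "3 * n > 0" using n by simp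
  have scale: "unit_root (3 * n) (3 * k) = unit_root n k" for k
    using unit_root_mult_left[of 3 n k] by simp
  show "inj_on (group_triple n) ({..<3 * n} \<times> {..<n})"
  proof (rule inj_onI, clarify)
    fix i j k l
    assume lt: "i < 3 * n" "j < n" "k < 3 * n" "l < n"
      and eq: "group_triple n (i, j) = group_triple n (k, l)"
    hence "unit_root (3 * n) (int i) = unit_root (3 * n) (int k)" by (simp add: group_triple_def)
    hence ik: "i = k"
      using lt inj_onD[OF bij_betw_imp_inj_on[OF bij_betw_unit_root[OF n3]], of i k] by simp
    from eq have "unit_root n (int j) = unit_root n (int l)"
      unfolding ik by (simp add: group_triple_def unit_root_add scale unit_root_nonzero)
    hence "j = l"
      using lt inj_onD[OF bij_betw_imp_inj_on[OF bij_betw_unit_root[OF n]], of j l] by simp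
    with ik show "i = k \<and> j = l" by simp
  qed
  show "group_triple n ` ({..<3 * n} \<times> {..<n}) =
    {(\<alpha>, \<beta>, \<gamma>). \<alpha> * \<beta> * \<gamma> = 1 \<and> \<alpha> ^ (3 * n) = 1 \<and> (\<alpha> / \<beta>) ^ n = 1}" (is "_ = ?A")
  proof (intro equalityI subsetI)
    fix t assume "t \<in> group_triple n ` ({..<3 * n} \<times> {..<n})"
    then obtain i j where t: "t = group_triple n (i, j)" by auto
    have "unit_root n (int j) * unit_root n (- int j) = 1"
      by (simp add: unit_root_0 flip: unit_root_add)
    hence "unit_root (3 * n) (int i) / unit_root (3 * n) (int i + 3 * int j) = unit_root n (- int j)"
      unfolding unit_root_add scale by (simp add: unit_root_nonzero unit_root_0 field_simps)
    thus "t \<in> ?A"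
      by (simp add: t group_triple_def unit_root_power unit_root_eq_1_iff[OF n] unit_root_eq_1_iff[OF n3]
          unit_root_0 flip: unit_root_add)
  next
    fix t assume "t \<in> ?A"
    then obtain \<alpha> \<beta> \<gamma> where t: "t = (\<alpha>, \<beta>, \<gamma>)" and prod: "\<alpha> * \<beta> * \<gamma> = 1" and \<alpha>: "\<alpha> ^ (3 * n) = 1"
      and div: "(\<alpha> / \<beta>) ^ n = 1" by auto
    have nz: "\<alpha> \<noteq> 0" "\<beta> \<noteq> 0" using prod by auto
    have "(\<beta> / \<alpha>) ^ n = 1" using div nz by (simp add: field_simps)
    then obtain j where j: "j < n" "\<beta> / \<alpha> = unit_root n (int j)"
      using bij_betw_imp_surj_on[OF bij_betw_unit_root[OF n]] by (auto simp: set_eq_iff image_iff)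
    obtain i where i: "i < 3 * n" "\<alpha> = unit_root (3 * n) (int i)"
      using \<alpha> bij_betw_imp_surj_on[OF bij_betw_unit_root[OF n3]] by (auto simp: set_eq_iff image_iff)
    have "\<alpha> * (\<beta> / \<alpha>) = unit_root (3 * n) (int i + 3 * int j)"
      unfolding unit_root_add scale j(2) by (simp only: i(2))
    hence \<beta>: "\<beta> = unit_root (3 * n) (int i + 3 * int j)" using nz by simp
    have "\<alpha> * \<beta> * unit_root (3 * n) (- 2 * int i - 3 * int j) = 1"
      unfolding i \<beta> unit_root_add[symmetric] by (simp add: unit_root_0)
    hence "\<alpha> * \<beta> * unit_root (3 * n) (- 2 * int i - 3 * int j) = \<alpha> * \<beta> * \<gamma>"
      using prod by simp
    hence "\<gamma> = unit_root (3 * n) (- 2 * int i - 3 * int j)" using nz by simp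
    with i \<beta> have "t = group_triple n (i, j)" by (simp add: t group_triple_def)
    with i j show "t \<in> group_triple n ` ({..<3 * n} \<times> {..<n})" by blast
  qed
qed

text \<open>The sum of the character \<open>\<alpha>\<^sup>x \<beta>\<^sup>y\<close> over that
  group.\<close>

definition char_sum :: "nat \<Rightarrow> int \<Rightarrow> int \<Rightarrow> complex" where
  "char_sum n x y = (\<Sum>(i, j)\<in>{..<3 * n} \<times> {..<n}. unit_root (3 * n) (int i * x + (int i + 3 * int j) * y))"

text \<open>Regrouping the exponent as \<open>i * (x + y) + 3 * j * y\<close> splits the sum into
  two sums over cyclic groups.\<close>

lemma char_sum_eq:
  assumes n: "n > 0"
  shows "char_sum n x y = (if int (3 * n) dvd x + y \<and> int n dvd y then of_nat (3 * n * n) else 0)"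
proof -
  have n3: "3 * n > 0" using n by simp
  have "char_sum n x y = (\<Sum>i<3 * n. \<Sum>j<n. unit_root (3 * n) (int i * (x + y)) * unit_root n (int j * y))"
    unfolding char_sum_def sum.cartesian_product[symmetric]
  proof (intro sum.cong refl)
    fix i j
    have "unit_root (3 * n) (int i * x + (int i + 3 * int j) * y)
        = unit_root (3 * n) (int i * (x + y) + int 3 * (int j * y))" by (simp add: algebra_simps)
    thus "unit_root (3 * n) (int i * x + (int i + 3 * int j) * y)
        = unit_root (3 * n) (int i * (x + y)) * unit_root n (int j * y)"
      by (simp only: unit_root_add unit_root_mult_left zero_less_numeral)
  qed
  also have "\<dots> = (\<Sum>i<3 * n. unit_root (3 * n) (int i * (x + y))) * (\<Sum>j<n. unit_root n (int j * y))"
    by (simp add: sum_product)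
  finally show ?thesis
    unfolding sum_unit_root[OF n] sum_unit_root[OF n3] by simp
qed

text \<open>The arguments are the exponents of the six monomials of the wave at
  \<open>(a, b)\<close>, with \<open>\<gamma>\<close> replaced by
  \<open>1 / (\<alpha> * \<beta>)\<close>, divided by the monomial at \<open>(c, d)\<close>. The
  alcove inequalities leave one pair of quotients \<open>k\<close>, \<open>l\<close> in each case,
  and just the unpermuted monomial can satisfy it.\<close>

lemma char_sum_alcove:
  assumes "(a, b) \<in> alcove n" "(c, d) \<in> alcove n"
  shows "char_sum n (a - c) (b - d) = (if (a, b) = (c, d) then of_nat (3 * n * n) else 0)"
    "char_sum n (b - c) (a - d) = 0" "char_sum n (- b - c) (a - b - d) = 0" "char_sum n (- a - c) (b - a - d) = 0"
    "char_sum n (b - a - c) (- a - d) = 0" "char_sum n (a - b - c) (- b - d) = 0"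
proof -
  have ab: "0 < b" "b < a" "a < int n" and cd: "0 < d" "d < c" "c < int n"
    using assms by (auto simp: alcove_def)
  hence n: "n > 0" by simp
  have dvd: "(int n dvd y \<and> int (3 * n) dvd x + y) \<longleftrightarrow> (\<exists>k l. y = int n * k \<and> x + y = int (3 * n) * l)" for x y
    by (auto simp: dvd_def)
  have small: "k = 0" if "\<bar>int m * k\<bar> < int m" for m k
  proof -
    have "int m > 0" using that by linarith
    moreover have "int m * \<bar>k\<bar> < int m * 1" using that by (simp add: abs_mult)
    ultimately have "\<bar>k\<bar> < 1" by (simp only: mult_less_cancel_left_pos)
    thus ?thesis by simp
  qed
  have one: "k = -1" if "int m * k < 0" "int m * k > - 2 * int m" for m k
  proof -
    have "int m > 0" using that by (cases "m = 0") auto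
    moreover have "int m * (- 2) < int m * k" "int m * k < int m * 0" using that by simp_all
    ultimately have "- 2 < k" "k < 0" by (simp_all only: mult_less_cancel_left_pos)
    thus ?thesis by simp
  qed
  have zero: "char_sum n x y = 0" if "\<And>k l. y = int n * k \<Longrightarrow> x + y = int (3 * n) * l \<Longrightarrow> False" for x y
    using that char_sum_eq[OF n, of x y] dvd[of y x] by auto
  show "char_sum n (a - c) (b - d) = (if (a, b) = (c, d) then of_nat (3 * n * n) else 0)"
  proof (cases "(a, b) = (c, d)")
    case False
    have "char_sum n (a - c) (b - d) = 0"
    proof (rule zero)
      fix k l assume "b - d = int n * k" "a - c + (b - d) = int (3 * n) * l"
      moreover from this have "k = 0" "l = 0" using ab cd small[of n k] small[of "3 * n" l] by simp_all
      ultimately show False using False by simp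
    qed
    with False show ?thesis by auto
  qed (simp add: char_sum_eq[OF n])
  show "char_sum n (b - c) (a - d) = 0"
  proof (rule zero)
    fix k l assume "a - d = int n * k" "b - c + (a - d) = int (3 * n) * l"
    moreover from this have "k = 0" "l = 0" using ab cd small[of n k] small[of "3 * n" l] by simp_all
    ultimately show False using ab cd by simp
  qed
  show "char_sum n (- b - c) (a - b - d) = 0"
  proof (rule zero)
    fix k l assume "a - b - d = int n * k" "- b - c + (a - b - d) = int (3 * n) * l"
    moreover from this have "k = 0" "l = 0" using ab cd small[of n k] small[of "3 * n" l] by simp_all
    ultimately show False using ab cd by simp
  qed
  \<comment> \<open>Both divisibilities together would give \<open>a + c = 2 * n\<close>, although
    \<open>a\<close> and \<open>c\<close> are less than \<open>n\<close>.\<close>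
  show "char_sum n (- a - c) (b - a - d) = 0"
  proof (rule zero)
    fix k l assume *: "b - a - d = int n * k" "- a - c + (b - a - d) = int (3 * n) * l"
    moreover have "k = -1" by (rule one[of n]; unfold *(1)[symmetric]; use ab cd in simp)
    moreover have "l = -1" by (rule one[of "3 * n"]; unfold *(2)[symmetric]; use ab cd in simp)
    ultimately show False using ab cd by simp
  qed
  show "char_sum n (b - a - c) (- a - d) = 0"
  proof (rule zero)
    fix k l assume *: "- a - d = int n * k" "b - a - c + (- a - d) = int (3 * n) * l"
    moreover have "k = -1" by (rule one[of n]; unfold *(1)[symmetric]; use ab cd in simp)
    moreover have "l = -1" by (rule one[of "3 * n"]; unfold *(2)[symmetric]; use ab cd in simp)
    ultimately show False using ab cd by simp
  qed
  show "char_sum n (a - b - c) (- b - d) = 0"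
  proof (rule zero)
    fix k l assume "- b - d = int n * k" "a - b - c + (- b - d) = int (3 * n) * l"
    moreover from this have "k = -1" "l = 0" using ab cd one[of n k] small[of "3 * n" l] by simp_all
    ultimately show False using ab cd by simp
  qed
qed

lemma sum_index_pairs:
  fixes f :: "nat \<times> nat \<Rightarrow> 'a :: comm_monoid_add"
  shows "(\<Sum>p\<in>index_pairs. f p) = f (0, 1) + f (1, 0) + f (1, 2) + f (2, 1) + f (2, 0) + f (0, 2)"
  by (simp add: index_pairs_def ac_simps)

lemma weight_triple_simps:
  fixes n :: nat
  defines "e \<equiv> \<lambda>u i. unit_root (3 * n) (weight u i)"
  shows "weight_triple n (u, 0, 1) = (e u 0, e u 1, e u 2)" "weight_triple n (u, 1, 0) = (e u 1, e u 0, e u 2)"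
    "weight_triple n (u, 1, 2) = (e u 1, e u 2, e u 0)" "weight_triple n (u, 2, 1) = (e u 2, e u 1, e u 0)"
    "weight_triple n (u, 2, 0) = (e u 2, e u 0, e u 1)" "weight_triple n (u, 0, 2) = (e u 0, e u 2, e u 1)"
proof -
  have "weight u 2 = - weight u 0 - weight u 1" using weight_sum[of u] by simp
  thus "weight_triple n (u, 0, 1) = (e u 0, e u 1, e u 2)" "weight_triple n (u, 1, 0) = (e u 1, e u 0, e u 2)"
    "weight_triple n (u, 1, 2) = (e u 1, e u 2, e u 0)" "weight_triple n (u, 2, 1) = (e u 2, e u 1, e u 0)"
    "weight_triple n (u, 2, 0) = (e u 2, e u 0, e u 1)" "weight_triple n (u, 0, 2) = (e u 0, e u 2, e u 1)"
    by (simp_all add: weight_triple_def e_def minus_diff_commute)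
qed

text \<open>Antisymmetry turns the sum into one over all ordered triples with a single monomial in
  place of the second wave. Triples with repeated entries add zero terms, so the sum extends to the
  whole group, where the characters are orthogonal.\<close>

lemma wave_orthogonality:
  assumes v: "v \<in> alcove n" and w: "w \<in> alcove n"
  shows "(\<Sum>u\<in>alcove n. wave (weight_triple n (u, 0, 1)) v * cnj (wave (weight_triple n (u, 0, 1)) w))
    = (if v = w then of_nat (3 * n * n) else 0)"
proof -
  obtain a b where ab: "v = (a, b)" by fastforce
  obtain c d where cd: "w = (c, d)" by fastforce
  have n: "n > 0" using v by (auto simp: alcove_def)
  \<comment> \<open>The first monomial of the wave at \<open>w\<close> is kept. Permuting the triple
    changes the wave at \<open>v\<close> by the sign, so the six orderings bring back the other
    monomials with their signs.\<close>
  define G where "G = (\<lambda>(\<alpha>, \<beta>, \<gamma>). wave (\<alpha>, \<beta>, \<gamma>) v * cnj (\<alpha> powi c * \<beta> powi d))"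
  define A where "A = {(\<alpha>, \<beta>, \<gamma>). \<alpha> * \<beta> * \<gamma> = 1 \<and> \<alpha> ^ (3 * n) = 1 \<and> (\<alpha> / \<beta>) ^ n = (1 :: complex)}"
  have bij: "bij_betw (group_triple n) ({..<3 * n} \<times> {..<n}) A"
    unfolding A_def by (rule bij_betw_group_triple[OF n])
  have finA: "finite A"
    using bij_betw_finite[OF bij] by simp
  have "(\<Sum>u\<in>alcove n. wave (weight_triple n (u, 0, 1)) v * cnj (wave (weight_triple n (u, 0, 1)) w))
      = (\<Sum>u\<in>alcove n. \<Sum>p\<in>index_pairs. G (weight_triple n (u, p)))"
    by (intro sum.cong refl)
      (simp add: sum_index_pairs weight_triple_simps[unfolded One_nat_def] G_def wave_def ab cd algebra_simps)
  also have "\<dots> = (\<Sum>x\<in>alcove n \<times> index_pairs. G (weight_triple n x))"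
    by (simp add: sum.cartesian_product split_def)
  also have "\<dots> = (\<Sum>t\<in>eigen_triples n. G t)"
    by (rule sum.reindex_bij_betw[OF bij_betw_weight_triple[OF n]])
  also have "\<dots> = (\<Sum>t\<in>A. G t)"
    by (rule sum.mono_neutral_left[OF finA]) (auto simp: eigen_triples_def A_def G_def wave_not_distinct)
  also have "\<dots> = (\<Sum>p\<in>{..<3 * n} \<times> {..<n}. G (group_triple n p))"
    by (rule sum.reindex_bij_betw[OF bij, symmetric])
  also have "\<dots> = char_sum n (a - c) (b - d) - char_sum n (b - c) (a - d) + char_sum n (- b - c) (a - b - d)
      - char_sum n (- a - c) (b - a - d) + char_sum n (b - a - c) (- a - d) - char_sum n (a - b - c) (- b - d)"
    unfolding char_sum_def sum_subtractf[symmetric] sum.distrib[symmetric]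
  proof (intro sum.cong refl)
    fix p :: "nat \<times> nat"
    obtain i j where p: "p = (i, j)" by fastforce
    show "G (group_triple n p) =
        (case p of (i, j) \<Rightarrow> unit_root (3 * n) (int i * (a - c) + (int i + 3 * int j) * (b - d))) -
        (case p of (i, j) \<Rightarrow> unit_root (3 * n) (int i * (b - c) + (int i + 3 * int j) * (a - d))) +
        (case p of (i, j) \<Rightarrow> unit_root (3 * n) (int i * (- b - c) + (int i + 3 * int j) * (a - b - d))) -
        (case p of (i, j) \<Rightarrow> unit_root (3 * n) (int i * (- a - c) + (int i + 3 * int j) * (b - a - d))) +
        (case p of (i, j) \<Rightarrow> unit_root (3 * n) (int i * (b - a - c) + (int i + 3 * int j) * (- a - d))) -
        (case p of (i, j) \<Rightarrow> unit_root (3 * n) (int i * (a - b - c) + (int i + 3 * int j) * (- b - d)))"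
      unfolding p group_triple_def G_def ab wave_def prod.case unit_root_powi complex_cnj_mult cnj_unit_root
        left_diff_distrib distrib_right unit_root_add[symmetric]
      by (simp add: algebra_simps)
  qed
  also have "\<dots> = (if v = w then of_nat (3 * n * n) else 0)"
    using char_sum_alcove v w unfolding ab cd by simp
  finally show ?thesis .
qed

section \<open>Counting the spanning trees\<close>

lemma triangle_digraph_simps:
  "verts (triangle_digraph n) = insert None (Some ` eisenstein ` alcove n)"
  "arcs (triangle_digraph n) = (\<lambda>(u, d). (eisenstein u, eisenstein d)) ` (alcove n \<times> {(1, 0), (0, 1), (-1, -1)})"
  "tail (triangle_digraph n) (eisenstein u, x) = Some (eisenstein u)"
  "u \<in> alcove n \<Longrightarrow> d \<in> {(1, 0), (0, 1), (-1, -1)} \<Longrightarrow>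
    head (triangle_digraph n) (eisenstein u, eisenstein d) =
      (if u + d \<in> alcove n then Some (eisenstein (u + d)) else None)"
proof -
  have "{1, omega, inverse omega} = eisenstein ` {(1, 0), (0, 1), (-1, -1)}"
    unfolding image_insert image_empty eisenstein_steps[symmetric] ..
  thus "arcs (triangle_digraph n) = (\<lambda>(u, d). (eisenstein u, eisenstein d)) ` (alcove n \<times> {(1, 0), (0, 1), (-1, -1)})"
    by (auto simp: triangle_digraph_def interior_points_eq)
qed (auto simp: triangle_digraph_def interior_points_eq eisenstein_add neighbour_in_frontier_iff)

lemma triangle_digraph_arcE:
  assumes "x \<in> arcs (triangle_digraph n)"
  obtains u d where "x = (eisenstein u, eisenstein d)" "u \<in> alcove n" "d \<in> {(1, 0), (0, 1), (-1, -1)}"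
proof -
  from assms obtain y where "x = (\<lambda>(u, d). (eisenstein u, eisenstein d)) y"
    "y \<in> alcove n \<times> {(1, 0), (0, 1), (-1, -1)}"
    unfolding triangle_digraph_simps by blast
  thus ?thesis by (intro that[of "fst y" "snd y"]) (auto simp: split_def)
qed

lemma fin_digraph_triangle_digraph: "fin_digraph (triangle_digraph n)"
proof
  fix x assume "x \<in> arcs (triangle_digraph n)"
  then obtain u d where x: "x = (eisenstein u, eisenstein d)" "u \<in> alcove n" "d \<in> {(1, 0), (0, 1), (-1, -1)}"
    by (rule triangle_digraph_arcE)
  show "tail (triangle_digraph n) x \<in> verts (triangle_digraph n)"
    "head (triangle_digraph n) x \<in> verts (triangle_digraph n)"
    unfolding x(1) triangle_digraph_simps(3) triangle_digraph_simps(4)[OF x(2,3)] using x(2)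
    by (auto simp: triangle_digraph_simps(1))
qed (simp_all add: triangle_digraph_simps finite_alcove)

lemma out_arcs_triangle_digraph:
  assumes "u \<in> alcove n"
  shows "out_arcs (triangle_digraph n) (Some (eisenstein u)) =
    (\<lambda>d. (eisenstein u, eisenstein d)) ` {(1, 0), (0, 1), (-1, -1)}"
proof (intro equalityI subsetI)
  fix x assume "x \<in> out_arcs (triangle_digraph n) (Some (eisenstein u))"
  hence x: "x \<in> arcs (triangle_digraph n)" "tail (triangle_digraph n) x = Some (eisenstein u)" by auto
  from x(1) obtain v d where vd: "x = (eisenstein v, eisenstein d)" "d \<in> {(1, 0), (0, 1), (-1, -1)}"
    by (rule triangle_digraph_arcE)
  from x(2) have "v = u" unfolding vd(1) triangle_digraph_simps(3) by (simp add: inj_eq[OF inj_eisenstein])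
  with vd show "x \<in> (\<lambda>d. (eisenstein u, eisenstein d)) ` {(1, 0), (0, 1), (-1, -1)}" by blast
next
  fix x assume "x \<in> (\<lambda>d. (eisenstein u, eisenstein d)) ` {(1, 0), (0, 1), (-1, -1)}"
  then obtain d where d: "x = (eisenstein u, eisenstein d)" "d \<in> {(1, 0), (0, 1), (-1, -1)}" by blast
  hence "x \<in> arcs (triangle_digraph n)"
    unfolding triangle_digraph_simps(2) using assms by (intro image_eqI[of _ _ "(u, d)"]) simp_all
  thus "x \<in> out_arcs (triangle_digraph n) (Some (eisenstein u))"
    by (simp add: d(1) triangle_digraph_simps(3))
qed

text \<open>Arcs into the root count towards the diagonal 3 but match no column, which is the zero
  boundary condition.\<close>

lemma laplacian_entry:
  assumes u: "u \<in> alcove n" and v: "v \<in> alcove n"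
  shows "(\<Sum>a\<in>out_arcs (triangle_digraph n) (Some (eisenstein u)).
      of_bool (u = v) - of_bool (head (triangle_digraph n) a = Some (eisenstein v))) =
    3 * of_bool (u = v) - (\<Sum>d\<in>{(1, 0), (0, 1), (-1, -1)}. of_bool (u + d = v) :: complex)"
proof -
  have inj: "inj_on (\<lambda>d. (eisenstein u, eisenstein d)) {(1, 0), (0, 1), (-1, -1)}"
    by (simp add: inj_on_def inj_eq[OF inj_eisenstein])
  have head: "head (triangle_digraph n) (eisenstein u, eisenstein d) = Some (eisenstein v) \<longleftrightarrow> u + d = v"
    if "d \<in> {(1, 0), (0, 1), (-1, -1)}" for d
    unfolding triangle_digraph_simps(4)[OF u that] using v by (auto simp: inj_eq[OF inj_eisenstein])
  have "(\<Sum>a\<in>out_arcs (triangle_digraph n) (Some (eisenstein u)).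
      of_bool (u = v) - of_bool (head (triangle_digraph n) a = Some (eisenstein v))) =
    (\<Sum>d\<in>{(1, 0), (0, 1), (-1, -1)}. of_bool (u = v) - of_bool (u + d = v) :: complex)"
    unfolding out_arcs_triangle_digraph[OF u] sum.reindex[OF inj] o_def
    by (intro sum.cong refl) (simp only: head)
  thus ?thesis by (simp add: sum_subtractf)
qed

section \<open>Diagonalization of the Laplacian\<close>

definition eigenvalue :: "complex \<times> complex \<times> complex \<Rightarrow> complex" where
  "eigenvalue = (\<lambda>(\<alpha>, \<beta>, \<gamma>). 3 - \<alpha> - \<beta> - \<gamma>)"

lemma eigenvalue_weight_triple:
  assumes "p \<in> index_pairs"
  shows "eigenvalue (weight_triple n (u, p)) = eigenvalue (weight_triple n (u, 0, 1))"
  using assms unfolding index_pairs_def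
  by (auto simp: weight_triple_simps[unfolded One_nat_def] eigenvalue_def)

text \<open>The waves are the columns of \<open>S\<close>, so \<open>L * S = S * D\<close> with the
  eigenvalues in \<open>D\<close>. Orthogonality makes the determinant of \<open>S\<close> nonzero,
  hence \<open>L\<close> and \<open>D\<close> have equal determinants, and the matrix-tree theorem
  reads that of \<open>L\<close> as the number of trees.\<close>

theorem card_directed_spanning_trees_triangle_digraph:
  "of_nat (card {F. directed_spanning_tree (triangle_digraph n) None F}) =
    (\<Prod>u\<in>alcove n. eigenvalue (weight_triple n (u, 0, 1)))"
proof -
  define m where "m = card (alcove n)"
  obtain e where e: "bij_betw e {0..<m} (alcove n)"
    unfolding m_def using ex_bij_betw_nat_finite[OF finite_alcove] by blast
  have mem: "e i \<in> alcove n" if "i < m" for i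
    using bij_betwE[OF e] that by simp
  have e_eq: "e i = e j \<longleftrightarrow> i = j" if "i < m" "j < m" for i j
    using that bij_betw_imp_inj_on[OF e] by (auto dest: inj_onD)
  have sum_e: "(\<Sum>i = 0..<m. f (e i)) = (\<Sum>u\<in>alcove n. f u)" for f :: "int \<times> int \<Rightarrow> complex"
    by (rule sum.reindex_bij_betw[OF e])
  define t where "t = (\<lambda>i. weight_triple n (e i, 0, 1))"
  define L where "L = (mat m m (\<lambda>(i, j). 3 * of_bool (i = j) -
    (\<Sum>d\<in>{(1, 0), (0, 1), (-1, -1)}. of_bool (e i + d = e j))) :: complex mat)"
  define S where "S = mat m m (\<lambda>(i, j). wave (t j) (e i))"
  define S' where "S' = mat m m (\<lambda>(j, i). cnj (wave (t j) (e i)))"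
  define D where "D = mat m m (\<lambda>(i, j). if i = j then eigenvalue (t i) else 0)"
  have dim: "L \<in> carrier_mat m m" "S \<in> carrier_mat m m" "S' \<in> carrier_mat m m" "D \<in> carrier_mat m m"
    by (simp_all add: L_def S_def S'_def D_def)
  have t_in: "t j \<in> eigen_triples n" if "j < m" for j
  proof -
    have "n > 0" using mem[OF that] by (auto simp: alcove_def)
    from bij_betwE[OF bij_betw_weight_triple[OF this]] mem[OF that] show ?thesis
      by (auto simp: t_def index_pairs_def)
  qed
  have LS: "L * S = S * D"
  proof (rule eq_matI)
    fix i k assume "i < dim_row (S * D)" "k < dim_col (S * D)"
    hence ik: "i < m" "k < m" using dim by auto
    obtain \<alpha> \<beta> \<gamma> where t: "t k = (\<alpha>, \<beta>, \<gamma>)" by (metis prod.exhaust)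
    with t_in[OF ik(2)] have prod: "\<alpha> * \<beta> * \<gamma> = 1" and \<alpha>: "\<alpha> ^ (3 * n) = 1" and div: "(\<alpha> / \<beta>) ^ n = 1"
      by (auto simp: eigen_triples_def)
    have "\<beta> \<noteq> 0" using prod by auto
    hence ab: "\<alpha> ^ n = \<beta> ^ n" using div by (simp add: power_divide)
    \<comment> \<open>Both \<open>(\<alpha> * \<beta> * \<gamma>) ^ n\<close> and
      \<open>\<beta> ^ (3 * n)\<close> are 1; cancelling gives
      \<open>\<beta> ^ n = \<gamma> ^ n\<close>, needed on the side \<open>a = n\<close>.\<close>
    have "\<alpha> ^ n * \<beta> ^ n * \<gamma> ^ n = 1"
      using prod by (simp flip: power_mult_distrib)
    moreover have "\<beta> ^ n * \<beta> ^ n * \<beta> ^ n = 1"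
      using \<alpha> unfolding mult.commute[of 3] power_mult ab power3_eq_cube .
    ultimately have "\<beta> ^ n * \<beta> ^ n * \<beta> ^ n = \<beta> ^ n * \<beta> ^ n * \<gamma> ^ n" by (simp add: ab)
    hence bc: "\<beta> ^ n = \<gamma> ^ n" using \<open>\<beta> \<noteq> 0\<close> by simp
    have delta: "(\<Sum>v\<in>alcove n. of_bool (u = v) * wave (t k) v) = (if u \<in> alcove n then wave (t k) u else 0)" for u
    proof -
      have "(\<Sum>v\<in>alcove n. of_bool (u = v) * wave (t k) v) = (\<Sum>v\<in>alcove n. if u = v then wave (t k) v else 0)"
        by (intro sum.cong) auto
      thus ?thesis by (simp add: finite_alcove)
    qed
    have "(L * S) $$ (i, k) = (\<Sum>j = 0..<m. L $$ (i, j) * S $$ (j, k))"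
      using ik dim by (simp add: scalar_prod_def)
    also have "\<dots> = (\<Sum>j = 0..<m. 3 * (of_bool (e i = e j) * wave (t k) (e j)) -
        (\<Sum>d\<in>{(1, 0), (0, 1), (-1, -1)}. of_bool (e i + d = e j) * wave (t k) (e j)))"
      using ik by (intro sum.cong refl) (simp add: L_def S_def e_eq algebra_simps)
    also have "\<dots> = 3 * (\<Sum>v\<in>alcove n. of_bool (e i = v) * wave (t k) v) -
        (\<Sum>d\<in>{(1, 0), (0, 1), (-1, -1)}. \<Sum>v\<in>alcove n. of_bool (e i + d = v) * wave (t k) v)"
      unfolding sum_subtractf sum_distrib_left sum_e[symmetric] by (subst sum.swap) (rule refl)
    also have "\<dots> = eigenvalue (t k) * wave (t k) (e i)"
      unfolding delta
      unfolding t wave_sum_steps[OF prod ab bc mem[OF ik(1)]]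
      using mem[OF ik(1)] by (simp add: eigenvalue_def algebra_simps)
    also have "\<dots> = (\<Sum>j = 0..<m. wave (t j) (e i) * (if j = k then eigenvalue (t j) else 0))"
      using ik by (simp add: if_distrib cong: if_cong)
    also have "\<dots> = (S * D) $$ (i, k)"
      using ik by (simp add: S_def D_def scalar_prod_def)
    finally show "(L * S) $$ (i, k) = (S * D) $$ (i, k)" .
  qed (use dim in auto)
  have "S * S' = of_nat (3 * n * n) \<cdot>\<^sub>m 1\<^sub>m m"
  proof (rule eq_matI)
    fix i k assume "i < dim_row (of_nat (3 * n * n) \<cdot>\<^sub>m 1\<^sub>m m :: complex mat)"
      "k < dim_col (of_nat (3 * n * n) \<cdot>\<^sub>m 1\<^sub>m m :: complex mat)"
    hence ik: "i < m" "k < m" by auto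
    have "(S * S') $$ (i, k) = (\<Sum>j = 0..<m. wave (t j) (e i) * cnj (wave (t j) (e k)))"
      using ik by (simp add: S_def S'_def scalar_prod_def)
    also have "\<dots> = (if e i = e k then of_nat (3 * n * n) else 0)"
      unfolding t_def sum_e[where f = "\<lambda>u. wave (weight_triple n (u, 0, 1)) (e i) * cnj (wave (weight_triple n (u, 0, 1)) (e k))"]
      by (rule wave_orthogonality[OF mem mem]) (fact ik)+
    finally show "(S * S') $$ (i, k) = (of_nat (3 * n * n) \<cdot>\<^sub>m 1\<^sub>m m) $$ (i, k)"
      using ik by (simp add: e_eq)
  qed (use dim in auto)
  hence "Determinant.det S * Determinant.det S' = of_nat (3 * n * n) ^ m"
    using det_mult[OF dim(2,3)] by simp
  \<comment> \<open>For \<open>n = 0\<close> the scalar vanishes, but the alcove is empty and the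
    power is \<open>0 ^ 0 = 1\<close>.\<close>
  moreover have "n > 0 \<or> m = 0"
    using mem[of 0] by (cases "m = 0") (auto simp: alcove_def)
  ultimately have nz: "Determinant.det S \<noteq> 0" by auto
  have "Determinant.det L * Determinant.det S = Determinant.det D * Determinant.det S"
    using LS det_mult[OF dim(1,2)] det_mult[OF dim(2,4)] by (simp only: mult.commute)
  hence det_L: "Determinant.det L = Determinant.det D" using nz by simp
  have "Determinant.det D = prod_list (diag_mat D)"
    by (rule det_upper_triangular[OF _ dim(4)]) (auto simp: D_def)
  also have "\<dots> = (\<Prod>i = 0..<m. eigenvalue (weight_triple n (e i, 0, 1)))"
    by (simp add: prod_list_diag_prod D_def t_def)
  also have "\<dots> = (\<Prod>u\<in>alcove n. eigenvalue (weight_triple n (u, 0, 1)))"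
    by (rule prod.reindex_bij_betw[OF e])
  finally have det_D: "Determinant.det D = (\<Prod>u\<in>alcove n. eigenvalue (weight_triple n (u, 0, 1)))" .
  have "bij_betw (\<lambda>u. Some (eisenstein u)) (alcove n) (Some ` eisenstein ` alcove n)"
    unfolding image_image by (rule inj_on_imp_bij_betw) (simp add: inj_on_def inj_eq[OF inj_eisenstein])
  also have "Some ` eisenstein ` alcove n = verts (triangle_digraph n) - {None}"
    by (auto simp: triangle_digraph_simps(1))
  finally have bij: "bij_betw (\<lambda>i. Some (eisenstein (e i))) {0..<m} (verts (triangle_digraph n) - {None})"
    using bij_betw_trans[OF e] by (auto simp: o_def)
  have "(\<Sum>a\<in>out_arcs (triangle_digraph n) (Some (eisenstein (e i))).
      of_bool (i = j) - of_bool (head (triangle_digraph n) a = Some (eisenstein (e j)))) =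
    3 * of_bool (i = j) - (\<Sum>d\<in>{(1, 0), (0, 1), (-1, -1)}. of_bool (e i + d = e j) :: complex)"
    if "i < m" "j < m" for i j
    using laplacian_entry[OF mem[OF that(1)] mem[OF that(2)]] by (simp only: e_eq[OF that])
  hence "L = mat m m (\<lambda>(i, j). \<Sum>a\<in>out_arcs (triangle_digraph n) (Some (eisenstein (e i))).
      of_bool (i = j) - of_bool (head (triangle_digraph n) a = Some (eisenstein (e j))))"
    unfolding L_def by (intro cong_mat) (simp_all only: prod.case)
  also have "Determinant.det \<dots> = of_nat (card {F. directed_spanning_tree (triangle_digraph n) None F})"
    by (rule matrix_tree_directed[OF fin_digraph_triangle_digraph _ bij]) (simp add: triangle_digraph_simps(1))
  finally show ?thesis using det_L det_D by simp
qed

section \<open>Sixth roots and ordered triples\<close>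

lemma card_index_pairs: "card index_pairs = 6"
  by (simp add: index_pairs_def)

text \<open>Taking the \<open>k\<close>-th power undoes the choice of the principal branch, and
  \<open>0 powr w = 0\<close> covers \<open>z = 0\<close>.\<close>

lemma powr_inverse_power: "k > 0 \<Longrightarrow> (z powr (1 / of_nat k)) ^ k = (z :: complex)"
  by (cases "z = 0") (simp_all add: powr_def flip: exp_of_nat_mult)

text \<open>The six orderings of a triple contribute the same principal sixth root of the same
  eigenvalue, so together they multiply to the eigenvalue itself.\<close>

theorem mainTheorem4:
  fixes n :: nat
  assumes "n \<ge> 3"
  shows "of_nat (card {F. directed_spanning_tree (triangle_digraph n) None F}) =
    (\<Prod>(\<alpha>, \<beta>, \<gamma>) \<in> eigen_triples n. (3 - \<alpha> - \<beta> - \<gamma>) powr (1 / 6))"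
proof -
  have "n > 0" using assms by simp
  have "(\<Prod>(\<alpha>, \<beta>, \<gamma>) \<in> eigen_triples n. (3 - \<alpha> - \<beta> - \<gamma>) powr (1 / 6))
      = (\<Prod>t \<in> eigen_triples n. eigenvalue t powr (1 / 6))"
    by (simp add: eigenvalue_def case_prod_unfold)
  also have "\<dots> = (\<Prod>x \<in> alcove n \<times> index_pairs. eigenvalue (weight_triple n x) powr (1 / 6))"
    by (rule prod.reindex_bij_betw[OF bij_betw_weight_triple[OF \<open>n > 0\<close>], symmetric])
  also have "\<dots> = (\<Prod>u\<in>alcove n. \<Prod>p\<in>index_pairs. eigenvalue (weight_triple n (u, p)) powr (1 / 6))"
    by (simp add: prod.cartesian_product split_def)
  also have "\<dots> = (\<Prod>u\<in>alcove n. (eigenvalue (weight_triple n (u, 0, 1)) powr (1 / of_nat 6)) ^ 6)"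
  proof (intro prod.cong refl)
    fix u
    have "(\<Prod>p\<in>index_pairs. eigenvalue (weight_triple n (u, p)) powr (1 / 6)) =
        (\<Prod>p\<in>index_pairs. eigenvalue (weight_triple n (u, 0, 1)) powr (1 / 6))"
      by (intro prod.cong refl) (simp only: eigenvalue_weight_triple)
    thus "(\<Prod>p\<in>index_pairs. eigenvalue (weight_triple n (u, p)) powr (1 / 6)) =
        (eigenvalue (weight_triple n (u, 0, 1)) powr (1 / of_nat 6)) ^ 6"
      by (simp only: prod_constant card_index_pairs of_nat_numeral)
  qed
  also have "\<dots> = of_nat (card {F. directed_spanning_tree (triangle_digraph n) None F})"
    unfolding card_directed_spanning_trees_triangle_digraph by (intro prod.cong refl powr_inverse_power) simp
  finally show ?thesis ..
qed

end
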